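(* Let $\alpha>0$, $\beta\ge0$, let $Z$ be a random variable with $\bar F_Z\in 2RV(-\alpha,\eta^* )$, where $\eta^*$ is regularly varying at infinity with index $-\alpha\beta$, let $X$ be a standard Gaussian random variable independent of $Z$, and let $\sigma:\mathbb R\to[0,\infty)$ be a measurable function with $\mathbb P(\sigma(X)>0)>0$ and $$\mathbb E[\sigma^{\alpha(\beta+1)+\epsilon}(X)]<\infty$$ for some $\epsilon>0$. Let $\bar F(y)=\mathbb P(\sigma(X)Z>y)$ and let $u_n\to\infty$. Then $\bar F\in 2RV(-\alpha,\eta^* )$ and $$\|T_n-T\|_\infty=\sup_{s\ge0}|T_n(s)-T(s)|=O(\eta^*(u_n)).$$ Moreover, for any $p\ge1$ such that $p\alpha(\beta+1)<\alpha(\beta+1)+\epsilon$, $$\mathbb E\left[\sup_{s\ge0}|G_n(X,s)-\sigma^\alpha(X)T(s)|^p\right]=O(\eta^*(u_n)^p).$$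
   Context: Second order regular variation: for a distribution tail $\bar F_V(z)=\mathbb P(V>z)$, the notation $\bar F_V\in 2RV(-\alpha,\eta^* )$ means that $\eta^*$ is a bounded nonincreasing function on $[0,\infty)$, regularly varying at infinity with index $-\alpha\beta$ for some $\beta\ge0$ and with $\lim_{t\to\infty}\eta^*(t)=0$, and that there exist a measurable function $\eta$ and constants $c,C>0$ such that $\mathbb P(V>z)=cz^{-\alpha}\exp\int_1^z\frac{\eta(s)}s\,\mathrm ds$ for all $z>0$ and $|\eta(s)|\le C\eta^*(s)$ for all $s\ge0$ (the functions $\eta$ and constants may differ for different tails). Notation: for $s\ge0$, $T(s)=(1+s)^{-\alpha}$, $T_n(s)=\bar F(u_n(1+s))/\bar F(u_n)$, and $G_n(x,s)=\mathbb P(\sigma(x)Z>(1+s)u_n)/\mathbb P(Z>u_n)$ for $x\in\mathbb R$. *)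

theory Defs
  imports "HOL-Probability.Probability" "HOL-Library.Landau_Symbols"
begin

definition tail :: "'a measure \<Rightarrow> ('a \<Rightarrow> real) \<Rightarrow> real \<Rightarrow> real" where
  "tail M V z = measure M {\<omega> \<in> space M. V \<omega> > z}"

text \<open>Functions on \<open>[0,\<infinity>)\<close> are total functions on the reals whose values at negative
  arguments are irrelevant.\<close>

definition regularly_varying :: "(real \<Rightarrow> real) \<Rightarrow> real \<Rightarrow> bool" where
  "regularly_varying f \<rho> \<longleftrightarrow>
     f \<in> borel_measurable (restrict_space borel {0<..}) \<and>
     (\<forall>\<^sub>F t in at_top. f t > 0) \<and>
     (\<forall>x>0. ((\<lambda>t. f (t * x) / f t) \<longlongrightarrow> x powr \<rho>) at_top)"

text \<open>The interval integral is oriented, so for \<open>z < 1\<close> it is minus the integral over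
  \<open>[z,1]\<close>. It always converges, since \<open>\<eta>\<close> is bounded on \<open>[0,\<infinity>)\<close>.\<close>

definition second_order_rv :: "(real \<Rightarrow> real) \<Rightarrow> real \<Rightarrow> (real \<Rightarrow> real) \<Rightarrow> bool" where
  "second_order_rv F \<alpha> \<eta>s \<longleftrightarrow>
     bounded (\<eta>s ` {0..}) \<and>
     antimono_on {0..} \<eta>s \<and>
     (\<exists>\<beta>\<ge>0. regularly_varying \<eta>s (- (\<alpha> * \<beta>))) \<and>
     (\<eta>s \<longlongrightarrow> 0) at_top \<and>
     (\<exists>\<eta> c C. \<eta> \<in> borel_measurable borel \<and> c > 0 \<and> C > 0 \<and>
        (\<forall>z>0. F z = c * z powr (- \<alpha>) * exp (LBINT s=1..ereal z. \<eta> s / s)) \<and>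
        (\<forall>s\<ge>0. \<bar>\<eta> s\<bar> \<le> C * \<eta>s s))"

definition T_lim :: "real \<Rightarrow> real \<Rightarrow> real" where
  "T_lim \<alpha> s = (1 + s) powr (- \<alpha>)"

definition T_level :: "(real \<Rightarrow> real) \<Rightarrow> real \<Rightarrow> real \<Rightarrow> real" where
  "T_level F u s = F (u * (1 + s)) / F u"

definition G_level ::
    "'a measure \<Rightarrow> ('a \<Rightarrow> real) \<Rightarrow> (real \<Rightarrow> real) \<Rightarrow> real \<Rightarrow> real \<Rightarrow> real \<Rightarrow> real" where
  "G_level M Z \<sigma> u x s = tail M (\<lambda>\<omega>. \<sigma> x * Z \<omega>) ((1 + s) * u) / tail M Z u"

text \<open>The two real suprema in question are over sets that are bounded above, hence genuine.\<close>

lemma tail_bounds: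
  assumes "prob_space M"
  shows "0 \<le> tail M V z" "tail M V z \<le> 1"
  using prob_space.prob_le_1[OF assms] by (simp_all add: tail_def)

lemma T_lim_bounds:
  assumes "\<alpha> > 0" "s \<ge> 0"
  shows "0 \<le> T_lim \<alpha> s" "T_lim \<alpha> s \<le> 1"
  using assms by (simp_all add: T_lim_def powr_minus ge_one_powr_ge_zero inverse_le_1_iff)

lemma bdd_above_T_level:
  assumes "prob_space M" "\<alpha> > 0"
  shows "bdd_above ((\<lambda>s. \<bar>T_level (tail M V) u s - T_lim \<alpha> s\<bar>) ` {0..})"
proof (rule bdd_aboveI2)
  fix s :: real assume "s \<in> {0..}"
  then have "0 \<le> T_lim \<alpha> s" "T_lim \<alpha> s \<le> 1" using T_lim_bounds assms by auto
  moreover have "0 \<le> T_level (tail M V) u s" "T_level (tail M V) u s \<le> 1 / tail M V u"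
    by (simp_all add: T_level_def tail_bounds[OF assms(1)] divide_right_mono)
  ultimately show "\<bar>T_level (tail M V) u s - T_lim \<alpha> s\<bar> \<le> 1 / tail M V u + 1" by linarith
qed

lemma bdd_above_G_level:
  assumes "prob_space M" "\<alpha> > 0" "p \<ge> 1"
  shows "bdd_above
    ((\<lambda>s. \<bar>G_level M Z \<sigma> u x s - \<sigma> x powr \<alpha> * T_lim \<alpha> s\<bar> powr p) ` {0..})"
proof (rule bdd_aboveI2)
  fix s :: real assume "s \<in> {0..}"
  then have "0 \<le> T_lim \<alpha> s" "T_lim \<alpha> s \<le> 1" using T_lim_bounds assms by auto
  then have "0 \<le> \<sigma> x powr \<alpha> * T_lim \<alpha> s" "\<sigma> x powr \<alpha> * T_lim \<alpha> s \<le> \<sigma> x powr \<alpha>"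
    by (simp_all add: mult_left_le)
  moreover have "0 \<le> G_level M Z \<sigma> u x s" "G_level M Z \<sigma> u x s \<le> 1 / tail M Z u"
    by (simp_all add: G_level_def tail_bounds[OF assms(1)] divide_right_mono)
  ultimately have "\<bar>G_level M Z \<sigma> u x s - \<sigma> x powr \<alpha> * T_lim \<alpha> s\<bar>
      \<le> 1 / tail M Z u + \<sigma> x powr \<alpha>" by linarith
  then show "\<bar>G_level M Z \<sigma> u x s - \<sigma> x powr \<alpha> * T_lim \<alpha> s\<bar> powr p
      \<le> (1 / tail M Z u + \<sigma> x powr \<alpha>) powr p"
    using assms(3) by (intro powr_mono2) auto
qed

end

theory Submission imports Defs begin

text \<open>
  Write \<open>H\<close> for the tail of \<open>Z\<close>, \<open>S\<close> for \<open>\<sigma> \<circ> X\<close> and \<open>F\<close> for the tail of \<open>S * Z\<close>.  Conditioning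
  on \<open>S\<close> gives \<open>F y = E[H (y / S); S > 0]\<close>, so everything is a matter of comparing \<open>H (t * v)\<close>
  with \<open>t powr (- \<alpha>) * H v\<close>, uniformly in \<open>t > 0\<close>, and averaging over \<open>t = 1 / S\<close>.

  The comparison (\<open>second_order_rv_ratio_bound\<close>).  The representation of \<open>H\<close> says that
  \<open>ln (H y) - ln (H x) + \<alpha> * (ln y - ln x)\<close> is the integral of \<open>\<eta> s / s\<close> over \<open>[x, y]\<close>, hence at most
  \<open>C * \<eta>s x * (ln y - ln x)\<close> because \<open>\<eta>s\<close> is nonincreasing.  For \<open>t \<ge> 1\<close> the logarithm is absorbed by
  half of the decay \<open>t powr (- \<alpha>)\<close>, and the error is \<open>K * \<eta>s v\<close>.  For \<open>t < 1\<close> the error involves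
  \<open>\<eta>s\<close> at the smaller argument \<open>t * v\<close>; Potter bounds for the nonincreasing functions \<open>\<eta>s\<close> (index
  \<open>- \<alpha> * \<beta>\<close>) and \<open>H * \<eta>s\<close> (index \<open>- \<alpha> * (\<beta> + 1)\<close>) bring it back to \<open>\<eta>s v\<close> at the price of a factor
  \<open>t powr (- r)\<close> with any \<open>r > \<alpha> * (\<beta> + 1)\<close>.  This is where the moment condition on \<open>S\<close> comes from.

  The representation of \<open>F\<close> (\<open>second_order_rv_product\<close>).  Formally, \<open>- s * H' s = H s * (\<alpha> - \<eta> s)\<close>
  almost everywhere, and averaging this over \<open>S\<close> gives the same equation for \<open>F\<close> with
  \<open>\<eta>F s = E[H (s / S) * \<eta> (s / S); S > 0] / F s\<close>.  The integrated form of the equation avoids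
  derivatives altogether: increments of \<open>ln H\<close> turn into increments of \<open>H\<close>
  (\<open>log_increments_iff_increments\<close>), these are averaged by Fubini's theorem, and the result
  is turned back into increments of \<open>ln F\<close>.  That \<open>\<eta>F\<close> is dominated by \<open>\<eta>s\<close> follows
  from the Potter bound for \<open>H * \<eta>s\<close> and from Breiman's lemma \<open>F v / H v \<longlongrightarrow> E[S powr \<alpha>] > 0\<close>,
  which is itself the comparison averaged over \<open>S\<close>.

  The two uniform estimates are then the comparison applied to \<open>F\<close> with \<open>t = 1 + s\<close>, and to \<open>H\<close>
  with \<open>t = (1 + s) / S\<close> and \<open>r = (\<alpha> * (\<beta> + 1) + \<epsilon>) / p\<close>, raised to the power \<open>p\<close> and integrated.
\<close>

section \<open>Logarithmic increments and the exponential representation\<close>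

lemma bounded_borel_integrable_on_interval:
  fixes f :: "real \<Rightarrow> real"
  assumes "f \<in> borel_measurable borel" and "\<And>s. s \<in> {x..y} \<Longrightarrow> \<bar>f s\<bar> \<le> K"
  shows "set_integrable lborel {x..y} f" and "f integrable_on {x..y}"
proof -
  have fin: "emeasure lborel {x..y} < \<infinity>"
    by (subst emeasure_lborel_Icc_eq) simp
  show 1: "set_integrable lborel {x..y} f"
    unfolding set_integrable_def
    by (rule integrableI_bounded_set_indicator[where B=K]) (use assms fin in auto)
  show "f integrable_on {x..y}"
    using set_borel_integral_eq_integral(1)[OF 1] .
qed

text \<open>
  The function \<open>y \<mapsto> \<phi> (G y) - \<integral>[a,y] \<phi>' (G s) * g s\<close> has derivative zero at every point, although \<open>G\<close>
  itself need not be differentiable anywhere: over a short interval at \<open>x\<close>, both terms differ from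
  \<open>\<phi>' (G x)\<close> times the increment of \<open>G\<close> by an error of smaller order than the length of the interval.
\<close>

lemma chain_rule_for_integral:
  fixes G g :: "real \<Rightarrow> real"
  assumes ab: "a \<le> b"
    and g: "g integrable_on {a..b}" and gK: "\<And>s. s \<in> {a..b} \<Longrightarrow> \<bar>g s\<bar> \<le> K"
    and G: "\<And>x y. a \<le> x \<Longrightarrow> x \<le> y \<Longrightarrow> y \<le> b \<Longrightarrow> G y - G x = integral {x..y} g"
    and \<phi>: "\<And>s. s \<in> {a..b} \<Longrightarrow> (\<phi> has_real_derivative \<phi>' (G s)) (at (G s))"
    and cont: "continuous_on (G ` {a..b}) \<phi>'"
    and int: "(\<lambda>s. \<phi>' (G s) * g s) integrable_on {a..b}"
  shows "\<phi> (G b) - \<phi> (G a) = integral {a..b} (\<lambda>s. \<phi>' (G s) * g s)"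
proof -
  define h where "h = (\<lambda>s. \<phi>' (G s) * g s)"
  define D where "D = (\<lambda>y. \<phi> (G y) - integral {a..y} h)"
  have K0: "K \<ge> 0" using gK[of a] ab by force
  have sub_g: "g integrable_on {x..y}" and sub_h: "h integrable_on {x..y}"
    if "a \<le> x" "y \<le> b" for x y
    using that g int unfolding h_def by (auto intro: integrable_on_subinterval)
  have lip: "\<bar>G y - G x\<bar> \<le> K * \<bar>y - x\<bar>" if "x \<in> {a..b}" "y \<in> {a..b}" for x y
  proof -
    have *: "\<bar>G y - G x\<bar> \<le> K * (y - x)" if "a \<le> x" "x \<le> y" "y \<le> b" for x y
      using G[OF that]
        has_integral_bound[OF K0, of g "integral {x..y} g" x y] sub_g[of x y] gK that
      by (auto simp: integrable_integral)
    show ?thesis using *[of x y] *[of y x] that by (cases "x \<le> y") (auto simp: abs_minus_commute)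
  qed
  have "(D has_field_derivative 0) (at x within {a..b})" if x: "x \<in> {a..b}" for x
    unfolding has_field_derivative_def has_derivative_within_alt
  proof (intro conjI allI impI)
    show "bounded_linear ((*) (0::real))" by (rule bounded_linear_mult_right)
    fix e :: real assume e: "e > 0"
    \<comment> \<open>The two errors below are each at most \<open>e1 * K * \<bar>y - x\<bar>\<close>; \<open>K + 1\<close> avoids a division by zero.\<close>
    define e1 where "e1 = e / (2 * (K + 1))"
    have e1: "e1 > 0" using e K0 by (simp add: e1_def)
    obtain d1 where d1: "d1 > 0"
      "\<And>z. \<bar>z - G x\<bar> < d1 \<Longrightarrow> \<bar>\<phi> z - \<phi> (G x) - \<phi>' (G x) * (z - G x)\<bar> \<le> e1 * \<bar>z - G x\<bar>"
      using \<phi>[OF x] e1 unfolding has_field_derivative_def has_derivative_at_alt by (auto; meson)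
    obtain d2 where d2: "d2 > 0"
      "\<And>z. z \<in> G ` {a..b} \<Longrightarrow> \<bar>z - G x\<bar> < d2 \<Longrightarrow> \<bar>\<phi>' z - \<phi>' (G x)\<bar> < e1"
      using cont x e1 unfolding continuous_on_iff dist_real_def by (metis imageI)
    define d where "d = min d1 d2 / (K + 1)"
    have d: "d > 0" using d1 d2 K0 by (simp add: d_def)
    show "\<exists>d>0. \<forall>y\<in>{a..b}. norm (y - x) < d \<longrightarrow> norm (D y - D x - 0 * (y - x)) \<le> e * norm (y - x)"
    proof (intro exI[of _ d] conjI ballI impI d)
      fix y assume y: "y \<in> {a..b}" and yx: "norm (y - x) < d"
      have close: "\<bar>G s - G x\<bar> < d1" "\<bar>G s - G x\<bar> < d2"
        if "s \<in> {a..b}" "\<bar>s - x\<bar> \<le> \<bar>y - x\<bar>" for s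
      proof -
        have "\<bar>G s - G x\<bar> \<le> K * \<bar>s - x\<bar>" using lip x that by blast
        also have "\<dots> \<le> (K + 1) * \<bar>y - x\<bar>" using K0 that by (intro mult_mono) auto
        also have "\<dots> < (K + 1) * d" using yx K0 by (intro mult_strict_left_mono) auto
        also have "\<dots> = min d1 d2" using K0 by (simp add: d_def)
        finally show "\<bar>G s - G x\<bar> < d1" "\<bar>G s - G x\<bar> < d2" by auto
      qed
      \<comment> \<open>Working on \<open>[l, r]\<close> treats points \<open>y\<close> on either side of \<open>x\<close> at once.\<close>
      define l where "l = min x y"
      define r where "r = max x y"
      have lr: "a \<le> l" "l \<le> r" "r \<le> b" "r - l = \<bar>y - x\<bar>" using x y by (auto simp: l_def r_def)
      have in_lr: "s \<in> {a..b}" "\<bar>s - x\<bar> \<le> \<bar>y - x\<bar>" if "s \<in> {l..r}" for s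
        using that x y by (auto simp: l_def r_def)
      have "\<bar>\<phi> (G y) - \<phi> (G x) - \<phi>' (G x) * (G y - G x)\<bar> \<le> e1 * \<bar>G y - G x\<bar>"
        using d1(2)[of "G y"] close y by simp
      also have "\<dots> \<le> e1 * (K * \<bar>y - x\<bar>)" using lip[OF x y] e1 by (intro mult_left_mono) auto
      finally have p1: "\<bar>\<phi> (G y) - \<phi> (G x) - \<phi>' (G x) * (G y - G x)\<bar> \<le> e1 * K * \<bar>y - x\<bar>" by simp
      have mg: "(\<lambda>s. \<phi>' (G x) * g s) integrable_on {l..r}" and int_h: "h integrable_on {l..r}"
        using sub_g[of l r] sub_h[of l r] lr by (auto intro: integrable_on_mult_right)
      have "integral {l..r} h - \<phi>' (G x) * (G r - G l) = integral {l..r} (\<lambda>s. h s - \<phi>' (G x) * g s)"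
        using lr G[of l r] mg int_h by (simp add: integral_diff)
      moreover have "norm (integral {l..r} (\<lambda>s. h s - \<phi>' (G x) * g s)) \<le> e1 * K * measure lborel (cbox l r)"
      proof (rule has_integral_bound)
        show "0 \<le> e1 * K" using e1 K0 by simp
        show "((\<lambda>s. h s - \<phi>' (G x) * g s) has_integral integral {l..r} (\<lambda>s. h s - \<phi>' (G x) * g s)) (cbox l r)"
          unfolding box_real by (intro integrable_integral integrable_diff int_h mg)
        fix s assume "s \<in> cbox l r"
        then have s: "s \<in> {l..r}" by simp
        have "\<bar>\<phi>' (G s) - \<phi>' (G x)\<bar> * \<bar>g s\<bar> \<le> e1 * K"
          using d2(2)[of "G s"] close[OF in_lr[OF s]] gK[OF in_lr(1)[OF s]] in_lr[OF s] e1
          by (intro mult_mono) (auto simp: less_imp_le)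
        then show "norm (h s - \<phi>' (G x) * g s) \<le> e1 * K"
          unfolding h_def left_diff_distrib[symmetric] real_norm_def abs_mult .
      qed
      ultimately have p2: "\<bar>integral {l..r} h - \<phi>' (G x) * (G r - G l)\<bar> \<le> e1 * K * \<bar>y - x\<bar>"
        using lr by simp
      have "D r - D l = \<phi> (G r) - \<phi> (G l) - integral {l..r} h"
      proof -
        have "integral {a..l} h + integral {l..r} h = integral {a..r} h"
          using lr by (intro Henstock_Kurzweil_Integration.integral_combine sub_h) auto
        then show ?thesis by (simp add: D_def)
      qed
      then have "\<bar>D r - D l\<bar> \<le> \<bar>\<phi> (G r) - \<phi> (G l) - \<phi>' (G x) * (G r - G l)\<bar>
          + \<bar>integral {l..r} h - \<phi>' (G x) * (G r - G l)\<bar>" by linarith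
      also have "\<bar>\<phi> (G r) - \<phi> (G l) - \<phi>' (G x) * (G r - G l)\<bar>
          = \<bar>\<phi> (G y) - \<phi> (G x) - \<phi>' (G x) * (G y - G x)\<bar>"
      proof (cases "x \<le> y")
        case False
        then have "\<phi> (G r) - \<phi> (G l) - \<phi>' (G x) * (G r - G l)
            = - (\<phi> (G y) - \<phi> (G x) - \<phi>' (G x) * (G y - G x))"
          by (simp add: l_def r_def algebra_simps)
        then show ?thesis by simp
      qed (simp add: l_def r_def)
      finally have "\<bar>D r - D l\<bar> \<le> 2 * (e1 * K * \<bar>y - x\<bar>)" using p1 p2 by linarith
      also have "\<dots> \<le> 2 * (e1 * (K + 1) * \<bar>y - x\<bar>)"
        using e1 by (intro mult_left_mono mult_right_mono) auto
      also have "\<dots> = e * \<bar>y - x\<bar>"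
      proof -
        have "2 * (K + 1) \<noteq> 0" using K0 by simp
        then show ?thesis unfolding e1_def by (simp del: distrib_left_numeral)
      qed
      finally have "\<bar>D r - D l\<bar> \<le> e * \<bar>y - x\<bar>" .
      then show "norm (D y - D x - 0 * (y - x)) \<le> e * norm (y - x)"
        by (cases "x \<le> y") (auto simp: l_def r_def abs_minus_commute)
    qed
  qed
  then obtain c where "\<forall>x\<in>{a..b}. D x = c"
    using has_field_derivative_zero_constant[of "{a..b}" D] by auto
  then have "D a = D b" using ab by auto
  then show ?thesis by (simp add: D_def h_def)
qed

text \<open>
  The exponential representation in the definition of second order regular variation, freed of its
  base point \<open>1\<close> and of its constant.
\<close>

lemma karamata_representation_iff_log_increments:
  fixes \<eta> F :: "real \<Rightarrow> real"
  assumes \<eta>: "\<eta> \<in> borel_measurable borel" and B: "\<And>s. s > 0 \<Longrightarrow> \<bar>\<eta> s\<bar> \<le> B"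
  shows "(\<exists>c>0. \<forall>z>0. F z = c * z powr (- \<alpha>) * exp (LBINT s=1..ereal z. \<eta> s / s)) \<longleftrightarrow>
    (\<forall>z>0. F z > 0) \<and>
    (\<forall>x y. 0 < x \<longrightarrow> x \<le> y \<longrightarrow> ln (F y) - ln (F x) = integral {x..y} (\<lambda>s. (\<eta> s - \<alpha>) / s))"
    (is "?L \<longleftrightarrow> ?pos \<and> ?R")
proof -
  define I where "I = (\<lambda>z::real. LBINT s=1..ereal z. \<eta> s / s)"
  have bnd: "\<bar>\<eta> s / s\<bar> \<le> B / x" if "0 < x" "s \<in> {x..y}" for x y s
  proof -
    have "\<bar>\<eta> s\<bar> / s \<le> B / x" using B[of s] that by (intro frac_le) auto
    then show ?thesis using that by simp
  qed
  have si: "set_integrable lborel {x..y} (\<lambda>s. \<eta> s / s)" if "0 < x" for x y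
    using \<eta> bnd[OF that] by (intro bounded_borel_integrable_on_interval(1)) auto
  have ii: "interval_lebesgue_integrable lborel (ereal x) (ereal y) (\<lambda>s. \<eta> s / s)"
    if "0 < x" "x \<le> y" for x y
    unfolding interval_lebesgue_integrable_def using that
    by (auto intro!: set_integrable_subset[OF si[OF that(1), of y]])
  have I: "I y - I x = integral {x..y} (\<lambda>s. \<eta> s / s)" if "0 < x" "x \<le> y" for x y
  proof -
    have "(LBINT s=1..ereal x. \<eta> s / s) + (LBINT s=ereal x..ereal y. \<eta> s / s) = (LBINT s=1..ereal y. \<eta> s / s)"
      using that ii[of "min 1 (min x y)" "max 1 (max x y)"]
      by (intro interval_integral_sum) (simp add: one_ereal_def ereal_min ereal_max del: ereal_eq_1)
    moreover have "(LBINT s=ereal x..ereal y. \<eta> s / s) = integral {x..y} (\<lambda>s. \<eta> s / s)"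
      using that si by (intro interval_integral_eq_integral) auto
    ultimately show ?thesis by (simp add: I_def)
  qed
  have incr: "integral {x..y} (\<lambda>s. (\<eta> s - \<alpha>) / s) = I y - I x - \<alpha> * (ln y - ln x)"
    if "0 < x" "x \<le> y" for x y
  proof -
    have "((\<lambda>s. \<alpha> / s) has_integral \<alpha> * ln y - \<alpha> * ln x) {x..y}"
      using that by (intro fundamental_theorem_of_calculus)
        (auto intro!: derivative_eq_intros simp flip: has_real_derivative_iff_has_vector_derivative)
    moreover have "((\<lambda>s. \<eta> s / s) has_integral I y - I x) {x..y}"
      unfolding I[OF that] using set_borel_integral_eq_integral(1)[OF si[OF that(1), of y]]
      by (rule integrable_integral)
    ultimately have "((\<lambda>s. \<eta> s / s - \<alpha> / s) has_integral (I y - I x) - (\<alpha> * ln y - \<alpha> * ln x)) {x..y}"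
      by (intro has_integral_diff)
    then show ?thesis by (simp add: integral_unique diff_divide_distrib right_diff_distrib)
  qed
  have I1: "I 1 = 0" by (simp add: I_def one_ereal_def del: ereal_eq_1)
  show ?thesis
  proof
    assume ?L
    then obtain c where c: "c > 0" "\<And>z. z > 0 \<Longrightarrow> F z = c * z powr (- \<alpha>) * exp (I z)"
      unfolding I_def by blast
    have ln: "ln (F z) = ln c - \<alpha> * ln z + I z" if "z > 0" for z
      using that c by (simp add: ln_mult)
    have "ln (F y) - ln (F x) = integral {x..y} (\<lambda>s. (\<eta> s - \<alpha>) / s)" if "0 < x" "x \<le> y" for x y
      using ln[of x] ln[of y] incr[OF that] that by (simp add: algebra_simps)
    then show "?pos \<and> ?R" using c by simp
  next
    assume *: "?pos \<and> ?R"
    have pos: "F z > 0" if "z > 0" for z using *[THEN conjunct1, rule_format, OF that] .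
    have R: "ln (F y) - ln (F x) = I y - I x - \<alpha> * (ln y - ln x)" if "0 < x" "x \<le> y" for x y
      using *[THEN conjunct2, rule_format, OF that] incr[OF that] by (rule trans)
    have eq: "F z = F 1 * z powr (- \<alpha>) * exp (I z)" if z: "z > 0" for z
    proof -
      have "ln (F z) - ln (F 1) = I z - \<alpha> * ln z"
        using R[of z 1] R[of 1 z] z I1 by (cases "z \<le> 1") auto
      then have "ln (F z) = ln (F 1 * z powr (- \<alpha>) * exp (I z))"
        using pos[of 1] z by (simp add: ln_mult)
      then show ?thesis using pos[of 1] pos[OF z] z by (subst (asm) ln_inj_iff) auto
    qed
    have "F 1 > 0 \<and> (\<forall>z>0. F z = F 1 * z powr (- \<alpha>) * exp (LBINT s=1..ereal z. \<eta> s / s))"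
      using conjI[OF pos[OF zero_less_one]] eq unfolding I_def by blast
    then show ?L by (rule exI)
  qed
qed

text \<open>
  The passage between \<open>(ln F)' = k\<close> and \<open>F' = F * k\<close> in integrated form: the chain rule for \<open>exp\<close> in one
  direction and for \<open>ln\<close> in the other.
\<close>

lemma log_increments_iff_increments:
  fixes F k :: "real \<Rightarrow> real"
  assumes F[measurable]: "F \<in> borel_measurable borel" and k[measurable]: "k \<in> borel_measurable borel"
    and pos: "\<And>z. 0 < z \<Longrightarrow> F z > 0" and anti: "\<And>x y. 0 < x \<Longrightarrow> x \<le> y \<Longrightarrow> F y \<le> F x"
    and k_bdd: "\<And>x s. 0 < x \<Longrightarrow> x \<le> s \<Longrightarrow> \<bar>k s\<bar> \<le> K / x"
  shows "(\<forall>x y. 0 < x \<longrightarrow> x \<le> y \<longrightarrow> ln (F y) - ln (F x) = integral {x..y} k) \<longleftrightarrow>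
    (\<forall>x y. 0 < x \<longrightarrow> x \<le> y \<longrightarrow> F y - F x = integral {x..y} (\<lambda>s. F s * k s))" (is "?L \<longleftrightarrow> ?R")
proof -
  have Fk_bdd: "\<bar>F s * k s\<bar> \<le> F x * (K / x)" if "0 < x" "x \<le> s" for x s
    unfolding abs_mult using that k_bdd[OF that] anti[OF that] pos[of s] pos[of x] by (intro mult_mono) auto
  have int_k: "k integrable_on {x..y}" and int_Fk: "(\<lambda>s. F s * k s) integrable_on {x..y}" if "0 < x" for x y
    by (rule bounded_borel_integrable_on_interval(2)[of _ _ _ "K / x"]; use k_bdd that in auto)
       (rule bounded_borel_integrable_on_interval(2)[of _ _ _ "F x * (K / x)"]; use Fk_bdd that in auto)
  show ?thesis
  proof
    assume L: ?L
    have "F y - F x = integral {x..y} (\<lambda>s. F s * k s)" if xy: "0 < x" "x \<le> y" for x y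
    proof -
      have eq: "exp (ln (F s)) = F s" if "s \<in> {x..y}" for s using pos[of s] that xy by simp
      have "exp (ln (F y)) - exp (ln (F x)) = integral {x..y} (\<lambda>s. exp (ln (F s)) * k s)"
      proof (rule chain_rule_for_integral[where G="\<lambda>s. ln (F s)" and K="K / x"])
        show "ln (F y') - ln (F x') = integral {x'..y'} k" if "x \<le> x'" "x' \<le> y'" for x' y'
          using L[rule_format, of x' y'] that xy by linarith
        show "(\<lambda>s. exp (ln (F s)) * k s) integrable_on {x..y}"
          using int_Fk[OF xy(1), of y] by (rule integrable_eq) (simp only: eq)
        show "(exp has_real_derivative exp (ln (F s))) (at (ln (F s)))" for s
          by (rule DERIV_exp)
      qed (use xy int_k k_bdd in \<open>auto intro: continuous_intros\<close>)
      moreover have "integral {x..y} (\<lambda>s. exp (ln (F s)) * k s) = integral {x..y} (\<lambda>s. F s * k s)"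
        by (intro Henstock_Kurzweil_Integration.integral_cong) (simp only: eq)
      ultimately show ?thesis using eq[of x] eq[of y] xy by simp
    qed
    then show ?R by blast
  next
    assume R: ?R
    have "ln (F y) - ln (F x) = integral {x..y} k" if xy: "0 < x" "x \<le> y" for x y
    proof -
      have eq: "1 / F s * (F s * k s) = k s" if "s \<in> {x..y}" for s using pos[of s] that xy by simp
      have "ln (F y) - ln (F x) = integral {x..y} (\<lambda>s. 1 / F s * (F s * k s))"
      proof (rule chain_rule_for_integral[where G=F and K="F x * (K / x)" and \<phi>'="\<lambda>z. 1 / z"])
        show "F y' - F x' = integral {x'..y'} (\<lambda>s. F s * k s)" if "x \<le> x'" "x' \<le> y'" for x' y'
          using R[rule_format, of x' y'] that xy by linarith
        show "(\<lambda>s. 1 / F s * (F s * k s)) integrable_on {x..y}"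
          using int_k[OF xy(1), of y] by (rule integrable_eq) (simp only: eq)
        show "(ln has_real_derivative 1 / F s) (at (F s))" if "s \<in> {x..y}" for s
          using pos[of s] that xy DERIV_ln_divide[of "F s"] by simp
        show "continuous_on (F ` {x..y}) (\<lambda>z. 1 / z)"
        proof (intro continuous_intros ballI)
          fix z assume "z \<in> F ` {x..y}"
          then obtain s where "s \<in> {x..y}" "z = F s" by blast
          then show "z \<noteq> 0" using pos[of s] xy by simp
        qed
      qed (use xy int_Fk Fk_bdd in auto)
      also have "\<dots> = integral {x..y} k"
        by (intro Henstock_Kurzweil_Integration.integral_cong) (simp only: eq)
      finally show ?thesis .
    qed
    then show ?L by blast
  qed
qed

section \<open>Uniform comparison of ratios with powers\<close>

lemma second_order_rv_etas_antimono:
  assumes "second_order_rv F \<alpha> \<eta>s" and "0 \<le> x" "x \<le> y"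
  shows "\<eta>s y \<le> \<eta>s x"
proof -
  have "antimono_on {0..} \<eta>s" using assms(1) unfolding second_order_rv_def by (elim conjE)
  then show ?thesis using assms by (auto simp: monotone_on_def)
qed

lemma second_order_rv_etas_tendsto_0: "second_order_rv F \<alpha> \<eta>s \<Longrightarrow> (\<eta>s \<longlongrightarrow> 0) at_top"
  unfolding second_order_rv_def by (elim conjE)

text \<open>
  Regular variation makes \<open>\<eta>s\<close> positive far out only; monotonicity carries positivity down to \<open>0\<close>.
\<close>

lemma second_order_rv_etas_pos:
  assumes "second_order_rv F \<alpha> \<eta>s" and "0 \<le> x"
  shows "\<eta>s x > 0"
proof -
  obtain \<rho> where "regularly_varying \<eta>s \<rho>"
    using assms(1) unfolding second_order_rv_def by (elim conjE exE) (rule that)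
  then have "\<forall>\<^sub>F t in at_top. \<eta>s t > 0" by (simp add: regularly_varying_def)
  then obtain t where "t \<ge> x" "\<eta>s t > 0"
    unfolding eventually_at_top_linorder by (metis nle_le)
  then show ?thesis using second_order_rv_etas_antimono[OF assms, of t] by simp
qed

lemma second_order_rv_log_increments:
  assumes rv: "second_order_rv F \<alpha> \<eta>s"
  obtains \<eta> C where "\<eta> \<in> borel_measurable borel" "C > 0" "\<And>s. s \<ge> 0 \<Longrightarrow> \<bar>\<eta> s\<bar> \<le> C * \<eta>s s"
    "\<And>z. z > 0 \<Longrightarrow> F z > 0"
    "\<And>x y. 0 < x \<Longrightarrow> x \<le> y \<Longrightarrow> ln (F y) - ln (F x) = integral {x..y} (\<lambda>s. (\<eta> s - \<alpha>) / s)"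
proof -
  obtain \<eta> c C where *: "\<eta> \<in> borel_measurable borel" "c > 0" "C > 0"
      "\<forall>z>0. F z = c * z powr (- \<alpha>) * exp (LBINT s=1..ereal z. \<eta> s / s)"
      "\<forall>s\<ge>0. \<bar>\<eta> s\<bar> \<le> C * \<eta>s s"
    using rv unfolding second_order_rv_def by (elim conjE exE) (rule that)
  note \<eta>C = *(5)[rule_format]
  have bnd: "\<bar>\<eta> s\<bar> \<le> C * \<eta>s 0" if "s > 0" for s
  proof -
    have "C * \<eta>s s \<le> C * \<eta>s 0"
      using second_order_rv_etas_antimono[OF rv, of 0 s] that *(3) by (intro mult_left_mono) auto
    then show ?thesis using \<eta>C[of s] that by linarith
  qed
  have rep: "(\<forall>z>0. F z > 0) \<and> (\<forall>x y. 0 < x \<longrightarrow> x \<le> y \<longrightarrow>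
      ln (F y) - ln (F x) = integral {x..y} (\<lambda>s. (\<eta> s - \<alpha>) / s))"
  proof (rule karamata_representation_iff_log_increments[where F=F and \<alpha>=\<alpha> and \<eta>=\<eta> and B="C * \<eta>s 0", THEN iffD1])
    show "\<eta> \<in> borel_measurable borel" by fact
    show "\<bar>\<eta> s\<bar> \<le> C * \<eta>s 0" if "0 < s" for s using bnd[OF that] .
    show "\<exists>c>0. \<forall>z>0. F z = c * z powr - \<alpha> * exp (LBINT s=1..ereal z. \<eta> s / s)"
      using conjI[OF *(2,4)] by (rule exI)
  qed
  show ?thesis
  proof (rule that)
    show "\<eta> \<in> borel_measurable borel" "C > 0" by fact+
    show "\<bar>\<eta> s\<bar> \<le> C * \<eta>s s" if "s \<ge> 0" for s using \<eta>C[OF that] .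
    show "F z > 0" if "z > 0" for z using rep[THEN conjunct1, rule_format, OF that] .
    show "ln (F y) - ln (F x) = integral {x..y} (\<lambda>s. (\<eta> s - \<alpha>) / s)" if "0 < x" "x \<le> y" for x y
      using rep[THEN conjunct2, rule_format, OF that] .
  qed
qed

lemma second_order_rv_pos:
  assumes "second_order_rv F \<alpha> \<eta>s" and "0 < z"
  shows "F z > 0"
proof -
  obtain \<eta> c where "c > 0" "\<forall>z>0. F z = c * z powr (- \<alpha>) * exp (LBINT s=1..ereal z. \<eta> s / s)"
    using assms(1) unfolding second_order_rv_def by (elim conjE exE) (rule that)
  then show ?thesis using assms(2) by simp
qed

lemma second_order_rv_log_ratio_bound:
  assumes rv: "second_order_rv F \<alpha> \<eta>s"
  obtains C where "C > 0" "\<And>x y. 0 < x \<Longrightarrow> x \<le> y \<Longrightarrow>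
    \<bar>ln (F y) - ln (F x) + \<alpha> * (ln y - ln x)\<bar> \<le> C * \<eta>s x * (ln y - ln x)"
proof -
  obtain \<eta> C where *: "\<eta> \<in> borel_measurable borel" "C > 0" "\<And>s. s \<ge> 0 \<Longrightarrow> \<bar>\<eta> s\<bar> \<le> C * \<eta>s s"
    "\<And>x y. 0 < x \<Longrightarrow> x \<le> y \<Longrightarrow> ln (F y) - ln (F x) = integral {x..y} (\<lambda>s. (\<eta> s - \<alpha>) / s)"
    by (rule second_order_rv_log_increments[OF rv]) (rule that)
  have "\<bar>ln (F y) - ln (F x) + \<alpha> * (ln y - ln x)\<bar> \<le> C * \<eta>s x * (ln y - ln x)"
    if xy: "0 < x" "x \<le> y" for x y
  proof -
    have log: "((\<lambda>s. k / s) has_integral k * (ln y - ln x)) {x..y}" for k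
      unfolding right_diff_distrib
      using xy by (intro fundamental_theorem_of_calculus)
        (auto intro!: derivative_eq_intros simp flip: has_real_derivative_iff_has_vector_derivative)
    have \<eta>x: "\<bar>\<eta> s\<bar> \<le> C * \<eta>s x" if "s \<in> {x..y}" for s
    proof -
      have "C * \<eta>s s \<le> C * \<eta>s x"
        using second_order_rv_etas_antimono[OF rv, of x s] that xy *(2) by (intro mult_left_mono) auto
      then show ?thesis using *(3)[of s] that xy by force
    qed
    have bnd: "\<bar>\<eta> s / s\<bar> \<le> C * \<eta>s x / s" if "s \<in> {x..y}" for s
      using \<eta>x[OF that] that xy by (simp add: divide_right_mono)
    have "\<bar>\<eta> s / s\<bar> \<le> C * \<eta>s x / x" if "s \<in> {x..y}" for s
    proof -
      have "C * \<eta>s x / s \<le> C * \<eta>s x / x"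
        using that xy *(2) second_order_rv_etas_pos[OF rv, of x] by (intro divide_left_mono) auto
      then show ?thesis using bnd[OF that] by linarith
    qed
    then have int: "(\<lambda>s. \<eta> s / s) integrable_on {x..y}"
      using *(1) by (intro bounded_borel_integrable_on_interval(2)) auto
    have "integral {x..y} (\<lambda>s. \<eta> s / s - \<alpha> / s) = integral {x..y} (\<lambda>s. \<eta> s / s) - \<alpha> * (ln y - ln x)"
      using int log[of \<alpha>] by (subst integral_diff) (auto simp: integral_unique)
    then have "ln (F y) - ln (F x) + \<alpha> * (ln y - ln x) = integral {x..y} (\<lambda>s. \<eta> s / s)"
      using *(4)[OF xy] by (simp add: diff_divide_distrib)
    also have "\<bar>\<dots>\<bar> \<le> integral {x..y} (\<lambda>s. C * \<eta>s x / s)"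
      using integral_norm_bound_integral[OF int, of "\<lambda>s. C * \<eta>s x / s"] log bnd by auto
    finally show ?thesis using integral_unique[OF log[of "C * \<eta>s x"]] by simp
  qed
  then show ?thesis by (rule that[OF *(2)])
qed

text \<open>
  For a monotone function the Potter bound needs no uniform convergence theorem: one halving of the
  argument costs a factor \<open>2 powr r\<close> above a threshold, halvings are iterated about \<open>log 2 y\<close> times, and
  below the threshold boundedness of \<open>h\<close> takes over.
\<close>

lemma potter_bound_monotone:
  fixes h :: "real \<Rightarrow> real"
  assumes anti: "\<And>x y. 0 < x \<Longrightarrow> x \<le> y \<Longrightarrow> h y \<le> h x"
    and pos: "\<And>x. 0 < x \<Longrightarrow> h x > 0" and bdd: "\<And>x. 0 < x \<Longrightarrow> h x \<le> B"
    and r: "r \<ge> 0" and doubling: "\<forall>\<^sub>F t in at_top. h t \<le> 2 powr r * h (2 * t)"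
  shows "\<exists>A>0. \<exists>t0>0. \<forall>w\<ge>t0. \<forall>y\<ge>1. h (w / y) \<le> A * y powr r * h w"
proof -
  obtain t1 where t1: "\<And>t. t \<ge> t1 \<Longrightarrow> h t \<le> 2 powr r * h (2 * t)"
    using doubling unfolding eventually_at_top_linorder by blast
  define t0 where "t0 = max t1 1"
  have t0: "t0 > 0" "\<And>t. t \<ge> t0 \<Longrightarrow> h t \<le> 2 powr r * h (2 * t)"
    using t1 by (auto simp: t0_def)
  define A where "A = max 1 (B / h (2 * t0))"
  have A: "A \<ge> 1" "B \<le> A * h (2 * t0)"
    using pos[of "2 * t0"] t0 by (auto simp: A_def field_simps max_def)
  have q: "2 powr r \<ge> 1" using r by (simp add: ge_one_powr_ge_zero)
  have chain: "h w \<le> A * (2 powr r) ^ k * h (2 ^ k * w)" if "w > 0" "2 ^ k * w \<ge> t0" for k w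
    using that
  proof (induction k)
    case 0
    then show ?case using A pos[of w] by simp
  next
    case (Suc k)
    show ?case
    proof (cases "2 ^ k * w \<ge> t0")
      case True
      have "h w \<le> A * (2 powr r) ^ k * h (2 ^ k * w)" using Suc True by simp
      also have "\<dots> \<le> A * (2 powr r) ^ k * (2 powr r * h (2 * (2 ^ k * w)))"
        using t0(2)[OF True] A by (intro mult_left_mono) auto
      finally show ?thesis by (simp add: mult_ac)
    next
      case False
      \<comment> \<open>Here \<open>2 ^ Suc k * w\<close> lies in \<open>[t0, 2 * t0)\<close>, and boundedness of \<open>h\<close> suffices.\<close>
      have "h w \<le> A * h (2 * t0)" using bdd[of w] Suc.prems A by linarith
      also have "\<dots> \<le> A * h (2 ^ Suc k * w)"
        using anti[of "2 ^ Suc k * w" "2 * t0"] False Suc.prems A t0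
        by (intro mult_left_mono) auto
      also have "\<dots> \<le> A * h (2 ^ Suc k * w) * (2 powr r) ^ Suc k"
      proof -
        have "1 \<le> (2 powr r) ^ Suc k" using q by (rule one_le_power)
        moreover have "0 \<le> A * h (2 ^ Suc k * w)"
          using A pos[of "2 ^ Suc k * w"] Suc.prems by (intro mult_nonneg_nonneg) auto
        ultimately show ?thesis using mult_left_mono by fastforce
      qed
      finally show ?thesis by (simp add: mult_ac)
    qed
  qed
  have "h (w / y) \<le> A * 2 powr r * y powr r * h w" if w: "w \<ge> t0" and y: "y \<ge> 1" for w y
  proof -
    define k where "k = nat \<lceil>log 2 y\<rceil>"
    have logy: "log 2 y \<ge> 0" using y by simp
    have k: "log 2 y \<le> real k" "real k < log 2 y + 1"
      unfolding k_def using logy by linarith+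
    have yk: "y \<le> 2 ^ k"
      using k(1) y by (simp add: log_le_iff powr_realpow)
    have ky: "2 ^ k \<le> 2 * y"
    proof -
      have "2 powr real k \<le> 2 powr (log 2 y + 1)" using k(2) by (intro powr_mono) auto
      then show ?thesis using y by (simp add: powr_add powr_realpow)
    qed
    have wk: "w \<le> 2 ^ k * (w / y)"
    proof -
      have "y * w \<le> 2 ^ k * w" using yk w t0 by (intro mult_right_mono) auto
      then show ?thesis using y by (simp add: field_simps)
    qed
    have wy: "w / y > 0" using w y t0 by simp
    have "h (w / y) \<le> A * (2 powr r) ^ k * h (2 ^ k * (w / y))"
      using wk w wy by (intro chain) auto
    also have "\<dots> \<le> A * (2 powr r) ^ k * h w"
      using anti[OF _ wk] w t0 A by (intro mult_left_mono) auto
    also have "(2 powr r) ^ k = (2 ^ k) powr r"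
      by (simp add: powr_power powr_powr mult.commute flip: powr_realpow)
    also have "A * (2 ^ k) powr r * h w \<le> A * (2 * y) powr r * h w"
      using ky r A pos[of w] w t0 by (intro mult_left_mono mult_right_mono powr_mono2) auto
    finally show ?thesis using y by (simp add: powr_mult mult_ac)
  qed
  then show ?thesis using A t0 by (intro exI[of _ "A * 2 powr r"] conjI exI[of _ t0]) auto
qed

lemma abs_exp_minus_one_le: "\<bar>exp x - 1\<bar> \<le> \<bar>x\<bar> * (1 + exp x)" for x :: real
proof -
  have "1 \<ge> (1 - x) * exp x"
    using mult_right_mono[OF exp_ge_add_one_self[of "-x"], of "exp x"] by (simp add: exp_minus)
  then have a: "exp x - 1 \<le> x * exp x" by (simp add: algebra_simps)
  have b: "x \<le> exp x - 1" using exp_ge_add_one_self[of x] by linarith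
  have "x * exp x \<le> \<bar>x\<bar> * exp x" by (intro mult_right_mono) auto
  moreover have "0 \<le> \<bar>x\<bar> * exp x" by simp
  moreover have "\<bar>x\<bar> * (1 + exp x) = \<bar>x\<bar> + \<bar>x\<bar> * exp x" by (simp add: algebra_simps)
  ultimately show ?thesis using a b by linarith
qed

text \<open>
  The ratio is \<open>(y / x) powr (- \<alpha>) * exp j\<close> with \<open>\<bar>j\<bar> \<le> J\<close>.  The first bound keeps the term \<open>F y / F x\<close>
  instead of estimating it by \<open>exp J\<close>: for \<open>y < x\<close> the exponent \<open>J\<close> is not small, while \<open>F y / F x\<close>
  can be controlled by a Potter bound.
\<close>

lemma ratio_bound_of_log_ratio_bound:
  fixes F :: "real \<Rightarrow> real"
  assumes "F x > 0" "F y > 0" "0 < x" "0 < y"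
    and "\<bar>ln (F y) - ln (F x) + \<alpha> * (ln y - ln x)\<bar> \<le> J"
  shows "\<bar>F y / F x - (y / x) powr (- \<alpha>)\<bar> \<le> J * ((y / x) powr (- \<alpha>) + F y / F x)"
    and "F y / F x \<le> (y / x) powr (- \<alpha>) * exp J"
proof -
  define j where "j = ln (F y) - ln (F x) + \<alpha> * (ln y - ln x)"
  have "F y / F x = exp (ln (F y) - ln (F x))" unfolding exp_diff using assms(1,2) by simp
  also have "\<dots> = exp (- \<alpha> * ln (y / x)) * exp j"
    using assms unfolding exp_add[symmetric] by (simp add: j_def ln_div algebra_simps)
  finally have eq: "F y / F x = (y / x) powr (- \<alpha>) * exp j"
    using assms by (simp add: powr_def)
  have "F y / F x - (y / x) powr (- \<alpha>) = (y / x) powr (- \<alpha>) * (exp j - 1)"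
    unfolding eq by (simp add: right_diff_distrib)
  then have "\<bar>F y / F x - (y / x) powr (- \<alpha>)\<bar> = (y / x) powr (- \<alpha>) * \<bar>exp j - 1\<bar>"
    by (simp add: abs_mult)
  also have "\<dots> \<le> (y / x) powr (- \<alpha>) * (J * (1 + exp j))"
  proof (intro mult_left_mono)
    have "\<bar>exp j - 1\<bar> \<le> \<bar>j\<bar> * (1 + exp j)" by (rule abs_exp_minus_one_le)
    also have "\<dots> \<le> J * (1 + exp j)" using assms j_def by (intro mult_right_mono) (auto intro: add_nonneg_nonneg)
    finally show "\<bar>exp j - 1\<bar> \<le> J * (1 + exp j)" .
  qed simp
  finally show "\<bar>F y / F x - (y / x) powr (- \<alpha>)\<bar> \<le> J * ((y / x) powr (- \<alpha>) + F y / F x)"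
    unfolding eq by (simp add: algebra_simps)
  show "F y / F x \<le> (y / x) powr (- \<alpha>) * exp J"
    unfolding eq using assms(5) j_def by (intro mult_left_mono) auto
qed

text \<open>
  Once \<open>C * \<eta>s v \<le> \<alpha> / 2\<close>, the factor \<open>t powr (C * \<eta>s v)\<close> eats at most half of the decay \<open>t powr (- \<alpha>)\<close>,
  and the other half compensates the logarithm in \<open>J\<close>.
\<close>

lemma second_order_rv_ratio_bound_right:
  assumes rv: "second_order_rv F \<alpha> \<eta>s" and \<alpha>: "\<alpha> > 0"
  shows "\<exists>K>0. \<exists>w0>0. \<forall>v\<ge>w0. \<forall>t\<ge>1. \<bar>F (t * v) / F v - t powr (- \<alpha>)\<bar> \<le> K * \<eta>s v"
proof -
  obtain C where C: "C > 0" "\<And>x y. 0 < x \<Longrightarrow> x \<le> y \<Longrightarrow>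
    \<bar>ln (F y) - ln (F x) + \<alpha> * (ln y - ln x)\<bar> \<le> C * \<eta>s x * (ln y - ln x)"
    by (rule second_order_rv_log_ratio_bound[OF rv]) (rule that)
  have pos: "F z > 0" if "z > 0" for z
    using second_order_rv_pos[OF rv that] .
  have "(\<eta>s \<longlongrightarrow> 0) at_top" by (rule second_order_rv_etas_tendsto_0[OF rv])
  then have "\<forall>\<^sub>F v in at_top. \<eta>s v < \<alpha> / (2 * C)"
    using \<alpha> C by (intro order_tendstoD) auto
  then obtain w1 where w1: "\<And>v. v \<ge> w1 \<Longrightarrow> \<eta>s v < \<alpha> / (2 * C)"
    unfolding eventually_at_top_linorder by blast
  define w0 where "w0 = max w1 1"
  have "\<bar>F (t * v) / F v - t powr (- \<alpha>)\<bar> \<le> (4 * C / \<alpha>) * \<eta>s v" if v: "v \<ge> w0" and t: "t \<ge> 1" for v t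
  proof -
    have v0: "v > 0" and Cv: "C * \<eta>s v \<le> \<alpha> / 2" using v w1[of v] C
      by (auto simp: w0_def field_simps)
    have \<eta>v: "\<eta>s v > 0" using second_order_rv_etas_pos[OF rv, of v] v0 by simp
    have lnt: "ln t \<ge> 0" using t by simp
    define J where "J = C * \<eta>s v * ln t"
    have "ln (t * v) - ln v = ln t" using t v0 by (simp add: ln_mult)
    then have "\<bar>ln (F (t * v)) - ln (F v) + \<alpha> * (ln (t * v) - ln v)\<bar> \<le> J"
      using C(2)[of v "t * v"] t v0 by (simp add: J_def)
    note R = ratio_bound_of_log_ratio_bound[OF pos pos v0 _ this]
    have "exp J \<le> exp (\<alpha> / 2 * ln t)"
      unfolding J_def using mult_right_mono[OF Cv lnt] by simp
    also have "\<dots> = t powr (\<alpha> / 2)" using t by (simp add: powr_def)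
    finally have eJ: "exp J \<le> t powr (\<alpha> / 2)" .
    have "F (t * v) / F v \<le> t powr (- \<alpha>) * exp J" using R(2) v0 t by simp
    also have "\<dots> \<le> t powr (- \<alpha>) * t powr (\<alpha> / 2)" using eJ by (intro mult_left_mono) auto
    also have "\<dots> = t powr (- \<alpha> / 2)" by (simp flip: powr_add)
    finally have Ft: "F (t * v) / F v \<le> t powr (- \<alpha> / 2)" .
    have ta: "t powr (- \<alpha>) \<le> t powr (- \<alpha> / 2)" using t \<alpha> by (intro powr_mono) auto
    have "ln t \<le> t powr (\<alpha> / 2) / (\<alpha> / 2)" using t \<alpha> by (intro ln_powr_bound) auto
    then have "ln t * t powr (- \<alpha> / 2) \<le> t powr (\<alpha> / 2) / (\<alpha> / 2) * t powr (- \<alpha> / 2)"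
      by (intro mult_right_mono) auto
    also have "\<dots> = 2 / \<alpha>" using t by (simp add: powr_minus)
    finally have ln: "ln t * t powr (- \<alpha> / 2) \<le> 2 / \<alpha>" .
    have "\<bar>F (t * v) / F v - t powr (- \<alpha>)\<bar> \<le> J * (t powr (- \<alpha>) + F (t * v) / F v)"
      using R(1) v0 t by simp
    also have "\<dots> \<le> J * (2 * t powr (- \<alpha> / 2))"
      using Ft ta C \<eta>v lnt by (intro mult_left_mono) (auto simp: J_def)
    also have "\<dots> = 2 * C * \<eta>s v * (ln t * t powr (- \<alpha> / 2))" by (simp add: J_def)
    also have "\<dots> \<le> 2 * C * \<eta>s v * (2 / \<alpha>)" using ln C \<eta>v by (intro mult_left_mono) auto
    finally show ?thesis by (simp add: field_simps)
  qed
  then show ?thesis using C \<alpha>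
    by (intro exI[of _ "4 * C / \<alpha>"] conjI exI[of _ w0]) (auto simp: w0_def)
qed

lemma regular_variation_doubling:
  fixes h :: "real \<Rightarrow> real"
  assumes "((\<lambda>t. h (2 * t) / h t) \<longlongrightarrow> 2 powr (- \<rho>)) at_top" and "\<rho> < r"
    and "\<And>x. 0 < x \<Longrightarrow> h x > 0"
  shows "\<forall>\<^sub>F t in at_top. h t \<le> 2 powr r * h (2 * t)"
proof -
  have "\<forall>\<^sub>F t in at_top. 2 powr (- r) < h (2 * t) / h t"
    using assms by (intro order_tendstoD(1)) auto
  then show ?thesis using eventually_gt_at_top[of 0]
  proof eventually_elim
    case (elim t)
    then have "2 powr (- r) * h t \<le> h (2 * t)" using assms(3)[of t] by (simp add: field_simps)
    then have "2 powr r * (2 powr (- r) * h t) \<le> 2 powr r * h (2 * t)" by (intro mult_left_mono) auto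
    then show ?case by (simp add: powr_minus flip: mult.assoc)
  qed
qed

text \<open>
  For \<open>t = 1 / y < 1\<close> the error is at most \<open>C * ln y * (\<eta>s (v / y) * y powr \<alpha> + \<eta>s (v / y) * F (v / y) / F v)\<close>.
  The Potter bounds for \<open>\<eta>s\<close> and for \<open>F * \<eta>s\<close> make both summands \<open>O(y powr r0 * \<eta>s v)\<close> for an exponent \<open>r0\<close>
  strictly between \<open>\<alpha> * (\<beta> + 1)\<close> and \<open>r\<close>; the gap \<open>r - r0\<close> absorbs \<open>ln y\<close>.  The second conclusion is the
  Potter bound itself.
\<close>

lemma second_order_rv_ratio_bound:
  assumes rv: "second_order_rv F \<alpha> \<eta>s" and reg: "regularly_varying \<eta>s (- (\<alpha> * \<beta>))"
    and \<alpha>: "\<alpha> > 0" and \<beta>: "\<beta> \<ge> 0"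
    and anti: "\<And>x y. 0 < x \<Longrightarrow> x \<le> y \<Longrightarrow> F y \<le> F x" and bdd: "\<And>x. 0 < x \<Longrightarrow> F x \<le> B"
    and r: "r > \<alpha> * (\<beta> + 1)"
  shows "\<exists>K>0. \<exists>A>0. \<exists>w0>0. \<forall>v\<ge>w0.
    (\<forall>t>0. \<bar>F (t * v) / F v - t powr (- \<alpha>)\<bar> \<le> K * \<eta>s v * (1 + t powr (- r))) \<and>
    (\<forall>y\<ge>1. F (v / y) * \<eta>s (v / y) \<le> A * y powr r * (F v * \<eta>s v))"
proof -
  obtain K1 w1 where K1: "K1 > 0" "w1 > 0"
    "\<And>v t. v \<ge> w1 \<Longrightarrow> t \<ge> 1 \<Longrightarrow> \<bar>F (t * v) / F v - t powr (- \<alpha>)\<bar> \<le> K1 * \<eta>s v"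
    using second_order_rv_ratio_bound_right[OF rv \<alpha>] by metis
  obtain C where C: "C > 0" "\<And>x y. 0 < x \<Longrightarrow> x \<le> y \<Longrightarrow>
    \<bar>ln (F y) - ln (F x) + \<alpha> * (ln y - ln x)\<bar> \<le> C * \<eta>s x * (ln y - ln x)"
    by (rule second_order_rv_log_ratio_bound[OF rv]) (rule that)
  have pos: "F z > 0" if "z > 0" for z
    using second_order_rv_pos[OF rv that] .
  have \<eta>pos: "\<eta>s x > 0" if "x > 0" for x using second_order_rv_etas_pos[OF rv, of x] that by simp
  have \<eta>anti: "\<eta>s y \<le> \<eta>s x" if "0 < x" "x \<le> y" for x y
    using second_order_rv_etas_antimono[OF rv, of x y] that by simp
  have \<eta>0: "\<eta>s x \<le> \<eta>s 0" if "0 < x" for x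
    using second_order_rv_etas_antimono[OF rv, of 0 x] that by simp
  have tend\<eta>: "((\<lambda>t. \<eta>s (2 * t) / \<eta>s t) \<longlongrightarrow> 2 powr (- (\<alpha> * \<beta>))) at_top"
    using reg[unfolded regularly_varying_def, THEN conjunct2, THEN conjunct2, rule_format, of 2]
    by (simp add: mult.commute)
  have "((\<lambda>t. F (2 * t) / F t - 2 powr (- \<alpha>)) \<longlongrightarrow> 0) at_top"
  proof (rule Lim_null_comparison)
    show "\<forall>\<^sub>F t in at_top. norm (F (2 * t) / F t - 2 powr (- \<alpha>)) \<le> K1 * \<eta>s t"
      using eventually_ge_at_top[of w1] by eventually_elim (use K1(3)[of _ 2] in auto)
    show "((\<lambda>t. K1 * \<eta>s t) \<longlongrightarrow> 0) at_top"
      by (intro tendsto_mult_right_zero second_order_rv_etas_tendsto_0[OF rv])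
  qed
  then have tendF: "((\<lambda>t. F (2 * t) / F t) \<longlongrightarrow> 2 powr (- \<alpha>)) at_top"
    by (simp add: LIM_zero_iff)
  define h where "h = (\<lambda>t. F t * \<eta>s t)"
  have hpos: "h x > 0" if "0 < x" for x using that pos \<eta>pos by (simp add: h_def)
  have tendh: "((\<lambda>t. h (2 * t) / h t) \<longlongrightarrow> 2 powr (- (\<alpha> * (\<beta> + 1)))) at_top"
    using tendsto_mult[OF tendF tend\<eta>]
    by (simp add: h_def algebra_simps flip: powr_add)
  define r0 where "r0 = (r + \<alpha> * (\<beta> + 1)) / 2"
  have r0: "r0 > \<alpha> * (\<beta> + 1)" "r0 < r" using r by (auto simp: r0_def)
  have ab: "\<alpha> * (\<beta> + 1) \<ge> 0" "\<alpha> * \<beta> \<ge> 0" "\<alpha> * (\<beta> + 1) = \<alpha> * \<beta> + \<alpha>"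
    using \<alpha> \<beta> by (auto simp: algebra_simps)
  have "\<exists>A>0. \<exists>t0>0. \<forall>w\<ge>t0. \<forall>y\<ge>1. h (w / y) \<le> A * y powr r0 * h w"
  proof (rule potter_bound_monotone[where B="B * \<eta>s 0"])
    show "h y \<le> h x" if "0 < x" "x \<le> y" for x y
      unfolding h_def using that anti \<eta>anti pos[of x] \<eta>pos[of y] by (intro mult_mono) auto
    show "h x \<le> B * \<eta>s 0" if "0 < x" for x
      unfolding h_def using that bdd[of x] \<eta>0[of x] pos[of x] \<eta>pos[of x]
      by (intro mult_mono) auto
    show "\<forall>\<^sub>F t in at_top. h t \<le> 2 powr r0 * h (2 * t)"
      using tendh r0(1) hpos by (rule regular_variation_doubling)
  qed (use r0 ab hpos in auto)
  then obtain A1 t1 where A1: "A1 > 0" "t1 > 0" "\<And>w y. w \<ge> t1 \<Longrightarrow> y \<ge> 1 \<Longrightarrow> h (w / y) \<le> A1 * y powr r0 * h w"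
    by blast
  have "\<exists>A>0. \<exists>t0>0. \<forall>w\<ge>t0. \<forall>y\<ge>1. \<eta>s (w / y) \<le> A * y powr (r0 - \<alpha>) * \<eta>s w"
  proof (rule potter_bound_monotone[where B="\<eta>s 0"])
    show "\<forall>\<^sub>F t in at_top. \<eta>s t \<le> 2 powr (r0 - \<alpha>) * \<eta>s (2 * t)"
      using tend\<eta> r0 ab \<eta>pos by (intro regular_variation_doubling[where \<rho>="\<alpha> * \<beta>"]) auto
  qed (use r0 ab \<eta>pos \<eta>0 \<eta>anti in auto)
  then obtain A2 t2 where A2: "A2 > 0" "t2 > 0"
    "\<And>w y. w \<ge> t2 \<Longrightarrow> y \<ge> 1 \<Longrightarrow> \<eta>s (w / y) \<le> A2 * y powr (r0 - \<alpha>) * \<eta>s w"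
    by blast
  define \<delta> where "\<delta> = r - r0"
  have \<delta>: "\<delta> > 0" using r0 by (simp add: \<delta>_def)
  define K2 where "K2 = C * (A1 + A2) / \<delta>"
  have K2: "K2 > 0" using C A1 A2 \<delta> by (simp add: K2_def)
  define w0 where "w0 = max w1 (max t1 t2)"
  have left: "\<bar>F (t * v) / F v - t powr (- \<alpha>)\<bar> \<le> K2 * \<eta>s v * t powr (- r)"
    if v: "v \<ge> w0" and t: "0 < t" "t < 1" for v t
  proof -
    define y where "y = 1 / t"
    have y: "y > 1" "t * v = v / y" "t = 1 / y" using t by (auto simp: y_def field_simps)
    have v0: "v > 0" "v \<ge> t1" "v \<ge> t2" using v A1 by (auto simp: w0_def)
    have vy: "v / y > 0" "v / y \<le> v" using y v0 by (auto simp: field_simps)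
    have lny: "ln y > 0" using y by simp
    define J where "J = C * \<eta>s (v / y) * ln y"
    have ln_vy: "ln (v / y) = ln v - ln y" using y v0 by (simp add: ln_div)
    have "\<bar>ln (F (v / y)) - ln (F v) + \<alpha> * (ln (v / y) - ln v)\<bar> \<le> J"
      using C(2)[OF vy] unfolding J_def ln_vy by (simp add: algebra_simps abs_minus_commute)
    from ratio_bound_of_log_ratio_bound(1)[OF pos pos _ _ this]
    have "\<bar>F (t * v) / F v - t powr (- \<alpha>)\<bar> \<le> J * (t powr (- \<alpha>) + F (t * v) / F v)"
      using v0 vy y by simp
    also have "J * (t powr (- \<alpha>) + F (t * v) / F v) = J * (y powr \<alpha> + F (t * v) / F v)"
      using t by (simp add: y_def powr_minus_divide powr_divide)
    also have "J * (y powr \<alpha> + F (t * v) / F v)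
        = C * ln y * (\<eta>s (v / y) * y powr \<alpha> + h (v / y) / F v)"
      unfolding y(2) by (simp add: J_def h_def algebra_simps)
    also have "\<dots> \<le> C * ln y * (A2 * \<eta>s v * y powr r0 + A1 * \<eta>s v * y powr r0)"
    proof (intro mult_left_mono add_mono)
      have "\<eta>s (v / y) * y powr \<alpha> \<le> A2 * y powr (r0 - \<alpha>) * \<eta>s v * y powr \<alpha>"
        using A2(3)[of v y] v0 y by (intro mult_right_mono) auto
      also have "\<dots> = A2 * \<eta>s v * (y powr (r0 - \<alpha>) * y powr \<alpha>)" by (simp add: mult_ac)
      finally show "\<eta>s (v / y) * y powr \<alpha> \<le> A2 * \<eta>s v * y powr r0"
        by (simp flip: powr_add)
      have "h (v / y) / F v \<le> A1 * y powr r0 * h v / F v"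
        using A1(3)[of v y] v0 y pos[of v] by (intro divide_right_mono) auto
      then show "h (v / y) / F v \<le> A1 * \<eta>s v * y powr r0"
        using pos[of v] v0 by (simp add: h_def mult_ac)
    qed (use C lny in auto)
    also have "\<dots> = C * (A1 + A2) * \<eta>s v * y powr r0 * ln y" by (simp add: algebra_simps)
    also have "\<dots> \<le> C * (A1 + A2) * \<eta>s v * y powr r0 * (y powr \<delta> / \<delta>)"
      using y \<delta> C A1 A2 \<eta>pos[OF v0(1)] ln_powr_bound[of y \<delta>] by (intro mult_left_mono) auto
    also have "\<dots> = K2 * \<eta>s v * (y powr r0 * y powr \<delta>)" by (simp add: K2_def)
    also have "y powr r0 * y powr \<delta> = y powr r" by (simp add: \<delta>_def flip: powr_add)
    also have "y powr r = t powr (- r)" using t by (simp add: y_def powr_minus_divide powr_divide)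
    finally show ?thesis .
  qed
  have main: "\<bar>F (t * v) / F v - t powr (- \<alpha>)\<bar> \<le> (K1 + K2) * \<eta>s v * (1 + t powr (- r))"
    if v: "v \<ge> w0" and t: "t > 0" for v t
  proof -
    have \<eta>v: "\<eta>s v > 0" using v K1 by (intro \<eta>pos) (auto simp: w0_def)
    have "\<bar>F (t * v) / F v - t powr (- \<alpha>)\<bar> \<le> K1 * \<eta>s v + K2 * \<eta>s v * t powr (- r)"
    proof (cases "t \<ge> 1")
      case True
      then have "\<bar>F (t * v) / F v - t powr (- \<alpha>)\<bar> \<le> K1 * \<eta>s v" using K1(3)[of v t] v by (simp add: w0_def)
      moreover have "0 \<le> K2 * \<eta>s v * t powr (- r)" using K2 \<eta>v by simp
      ultimately show ?thesis by linarith
    next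
      case False
      moreover have "0 \<le> K1 * \<eta>s v" using K1 \<eta>v by simp
      ultimately show ?thesis using left[OF v, of t] t by linarith
    qed
    also have "\<dots> \<le> (K1 + K2) * \<eta>s v * (1 + t powr (- r))"
    proof -
      have "0 \<le> K2 * \<eta>s v" "0 \<le> K1 * \<eta>s v * t powr (- r)" using K1 K2 \<eta>v by auto
      then show ?thesis by (simp add: algebra_simps)
    qed
    finally show ?thesis .
  qed
  have "F (v / y) * \<eta>s (v / y) \<le> A1 * y powr r * (F v * \<eta>s v)" if v: "v \<ge> w0" and y: "y \<ge> 1" for v y
  proof -
    have v': "v \<ge> t1" "v > 0" using v A1 by (auto simp: w0_def)
    have "h (v / y) \<le> A1 * y powr r0 * h v" using A1(3) v' y by blast
    also have "\<dots> \<le> A1 * y powr r * h v"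
      using A1 hpos[OF v'(2)] r0 y by (intro mult_left_mono mult_right_mono powr_mono) auto
    finally show ?thesis by (simp add: h_def)
  qed
  then show ?thesis using main K1 K2 A1
    by (intro exI[of _ "K1 + K2"] exI[of _ A1] exI[of _ w0] conjI) (auto simp: w0_def)
qed

section \<open>Tails of products with an independent factor\<close>

lemma tail_antimono:
  assumes "prob_space M" and [measurable]: "V \<in> borel_measurable M" and "x \<le> y"
  shows "tail M V y \<le> tail M V x"
proof -
  interpret prob_space M by fact
  show ?thesis unfolding tail_def using \<open>x \<le> y\<close> by (intro finite_measure_mono) auto
qed

lemma borel_measurable_tail:
  assumes "prob_space M" "V \<in> borel_measurable M"
  shows "tail M V \<in> borel_measurable borel"
proof -
  have "(\<lambda>z. - tail M V z) \<in> borel_measurable borel"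
    using tail_antimono[OF assms] by (intro borel_measurable_mono monoI) simp
  from borel_measurable_uminus[OF this] show ?thesis by simp
qed

lemma tail_right_continuous:
  assumes "prob_space M" and [measurable]: "V \<in> borel_measurable M"
  shows "(tail M V \<longlongrightarrow> tail M V z) (at_right z)"
proof -
  interpret prob_space M by fact
  interpret D: real_distribution "distr M borel V"
    by (intro real_distribution_distr) simp
  have eq: "tail M V z = 1 - cdf (distr M borel V) z" for z
  proof -
    have "cdf (distr M borel V) z = prob (V -` {..z} \<inter> space M)"
      by (simp add: cdf_def measure_distr)
    moreover have "{\<omega> \<in> space M. V \<omega> > z} = space M - (V -` {..z} \<inter> space M)" by auto
    ultimately show ?thesis unfolding tail_def by (simp add: prob_compl)
  qed
  have "(cdf (distr M borel V) \<longlongrightarrow> cdf (distr M borel V) z) (at_right z)"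
    using D.cdf_is_right_cont[of z] by (simp add: continuous_within)
  then show ?thesis unfolding eq by (intro tendsto_intros)
qed

lemma tail_scaled:
  assumes "\<sigma> \<ge> 0" "y > 0"
  shows "tail M (\<lambda>\<omega>. \<sigma> * Z \<omega>) y = (if \<sigma> = 0 then 0 else tail M Z (y / \<sigma>))"
  using assms by (auto simp: tail_def field_simps)

text \<open>
  Independence makes the joint law of \<open>(S, Z)\<close> a product measure, so \<open>S\<close> can be frozen.
\<close>

lemma tail_product_indep:
  assumes "prob_space M" and indep: "prob_space.indep_var M borel S borel Z"
  shows "tail M (\<lambda>\<omega>. S \<omega> * Z \<omega>) y = (\<integral>\<omega>. tail M (\<lambda>\<omega>'. S \<omega> * Z \<omega>') y \<partial>M)"
proof -
  interpret prob_space M by fact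
  have [measurable]: "S \<in> borel_measurable M" "Z \<in> borel_measurable M"
    and joint: "distr M borel S \<Otimes>\<^sub>M distr M borel Z = distr M (borel \<Otimes>\<^sub>M borel) (\<lambda>\<omega>. (S \<omega>, Z \<omega>))"
    using indep unfolding indep_var_distribution_eq by auto
  interpret S: prob_space "distr M borel S" by (intro prob_space_distr) simp
  interpret Z: prob_space "distr M borel Z" by (intro prob_space_distr) simp
  interpret P: pair_prob_space "distr M borel S" "distr M borel Z" ..
  define A where "A = {p :: real \<times> real. fst p * snd p > y}"
  have A[measurable]: "A \<in> sets (borel \<Otimes>\<^sub>M borel)"
  proof -
    have eq: "A = (\<lambda>p. fst p * snd p) -` {y<..} \<inter> space (borel \<Otimes>\<^sub>M borel)"
      by (auto simp: A_def space_pair_measure)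
    have "(\<lambda>p. fst p * snd p :: real) \<in> borel_measurable (borel \<Otimes>\<^sub>M borel)"
      by measurable
    then show ?thesis unfolding eq by (rule measurable_sets) simp
  qed
  have "tail M (\<lambda>\<omega>. S \<omega> * Z \<omega>) y = measure (distr M (borel \<Otimes>\<^sub>M borel) (\<lambda>\<omega>. (S \<omega>, Z \<omega>))) A"
  proof -
    have "(\<lambda>\<omega>. (S \<omega>, Z \<omega>)) \<in> measurable M (borel \<Otimes>\<^sub>M borel)" by measurable
    from measure_distr[OF this A] show ?thesis
      unfolding tail_def by (auto simp: A_def intro!: arg_cong[where f=prob])
  qed
  also have "\<dots> = (\<integral>p. indicator A p \<partial>(distr M borel S \<Otimes>\<^sub>M distr M borel Z))"
    unfolding joint by (simp add: space_pair_measure)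
  also have "\<dots> = (\<integral>s. (\<integral>z. indicator A (s, z) \<partial>distr M borel Z) \<partial>distr M borel S)"
    by (subst P.integral_fst') (auto intro!: P.P.integrable_const_bound[where B=1] simp: indicator_def)
  also have "\<dots> = (\<integral>\<omega>. (\<integral>z. indicator A (S \<omega>, z) \<partial>distr M borel Z) \<partial>M)"
    by (subst integral_distr) auto
  also have "\<dots> = (\<integral>\<omega>. tail M (\<lambda>\<omega>'. S \<omega> * Z \<omega>') y \<partial>M)"
  proof (intro Bochner_Integration.integral_cong refl)
    fix \<omega>
    have "(\<integral>z. indicator A (S \<omega>, z) \<partial>distr M borel Z) = (\<integral>\<omega>'. indicat_real A (S \<omega>, Z \<omega>') \<partial>M)"
      by (subst integral_distr) auto
    also have "\<dots> = (\<integral>\<omega>'. indicat_real {\<omega>'\<in>space M. S \<omega> * Z \<omega>' > y} \<omega>' \<partial>M)"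
      by (rule Bochner_Integration.integral_cong[OF refl]) (simp add: A_def indicator_def)
    finally show "(\<integral>z. indicator A (S \<omega>, z) \<partial>distr M borel Z) = tail M (\<lambda>\<omega>'. S \<omega> * Z \<omega>') y"
      by (simp add: tail_def)
  qed
  finally show ?thesis .
qed

lemma powr_le_one_plus_powr:
  fixes s a b :: real
  assumes "0 \<le> a" "0 \<le> s" "a \<le> b"
  shows "s powr a \<le> 1 + s powr b"
  using powr_mono[of a b s] powr_mono2[of a s 1] assms by (cases "s \<le> 1") (auto simp: add_increasing add_increasing2)

text \<open>
  This is the comparison at \<open>t / \<sigma>\<close>.  The value \<open>\<sigma> = 0\<close> fits in, since then both terms vanish.
\<close>

lemma scaled_tail_ratio_bound:
  assumes M: "prob_space M" and Z: "Z \<in> borel_measurable M"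
    and rv: "second_order_rv (tail M Z) \<alpha> \<eta>s" and reg: "regularly_varying \<eta>s (- (\<alpha> * \<beta>))"
    and \<alpha>: "\<alpha> > 0" and \<beta>: "\<beta> \<ge> 0" and r: "r > \<alpha> * (\<beta> + 1)"
  shows "\<exists>K>0. \<exists>w0>0. \<forall>v\<ge>w0. \<forall>\<sigma>\<ge>0. \<forall>t\<ge>1.
    \<bar>tail M (\<lambda>\<omega>. \<sigma> * Z \<omega>) (t * v) / tail M Z v - \<sigma> powr \<alpha> * t powr (- \<alpha>)\<bar>
      \<le> K * \<eta>s v * (1 + \<sigma> powr r)"
proof -
  obtain K w0 where K: "K > 0" "w0 > 0" "\<And>v t. v \<ge> w0 \<Longrightarrow> t > 0 \<Longrightarrow>
      \<bar>tail M Z (t * v) / tail M Z v - t powr (- \<alpha>)\<bar> \<le> K * \<eta>s v * (1 + t powr (- r))"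
    using second_order_rv_ratio_bound[OF rv reg \<alpha> \<beta> _ _ r, of 1]
      tail_antimono[OF M Z] tail_bounds[OF M] by metis
  have r0: "r > 0" using r \<alpha> \<beta> by (smt (verit) mult_nonneg_nonneg)
  have "\<bar>tail M (\<lambda>\<omega>. \<sigma> * Z \<omega>) (t * v) / tail M Z v - \<sigma> powr \<alpha> * t powr (- \<alpha>)\<bar>
      \<le> K * \<eta>s v * (1 + \<sigma> powr r)" if v: "v \<ge> w0" and \<sigma>: "\<sigma> \<ge> 0" and t: "t \<ge> 1" for v \<sigma> t
  proof -
    have \<eta>v: "\<eta>s v > 0" and v0: "v > 0" using second_order_rv_etas_pos[OF rv, of v] v K by auto
    show ?thesis
    proof (cases "\<sigma> = 0")
      case True
      then show ?thesis using K \<eta>v tail_scaled[of \<sigma> "t * v" M Z] t v0 by simp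
    next
      case False
      with \<sigma> have \<sigma>: "\<sigma> > 0" by simp
      have "\<bar>tail M Z (t / \<sigma> * v) / tail M Z v - (t / \<sigma>) powr (- \<alpha>)\<bar> \<le> K * \<eta>s v * (1 + (t / \<sigma>) powr (- r))"
        using K(3)[OF v, of "t / \<sigma>"] \<sigma> t by simp
      moreover have "tail M (\<lambda>\<omega>. \<sigma> * Z \<omega>) (t * v) = tail M Z (t / \<sigma> * v)"
        using tail_scaled[of \<sigma> "t * v" M Z] \<sigma> t v0 by simp
      moreover have flip: "(t / \<sigma>) powr (- a) = \<sigma> powr a * t powr (- a)" for a
        using \<sigma> t by (simp add: powr_minus powr_divide divide_simps)
      moreover have "\<sigma> powr r * t powr (- r) \<le> \<sigma> powr r"
        using t r0 powr_mono[of "- r" 0 t] by (intro mult_left_le) auto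
      then have "K * \<eta>s v * (1 + \<sigma> powr r * t powr (- r)) \<le> K * \<eta>s v * (1 + \<sigma> powr r)"
        using K \<eta>v by (intro mult_left_mono) auto
      ultimately show ?thesis by simp
    qed
  qed
  then show ?thesis using K by blast
qed

section \<open>Second order regular variation of the product\<close>

lemma integral_scaled_interval:
  fixes f :: "real \<Rightarrow> real"
  assumes "\<sigma> > 0" and "f integrable_on {x / \<sigma>..y / \<sigma>}"
  shows "integral {x / \<sigma>..y / \<sigma>} f = integral {x..y} (\<lambda>s. f (s / \<sigma>) / \<sigma>)"
proof -
  have "(\<lambda>u. u / (1 / \<sigma>)) ` {x / \<sigma>..y / \<sigma>} = {x..y}"
  proof -
    have "u \<in> (\<lambda>u. u / (1 / \<sigma>)) ` {x / \<sigma>..y / \<sigma>}" if "u \<in> {x..y}" for u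
      using that assms by (intro image_eqI[of _ _ "u / \<sigma>"]) (auto simp: divide_right_mono)
    then show ?thesis using assms by (auto simp: field_simps)
  qed
  then have "((\<lambda>s. f (1 / \<sigma> * s)) has_integral \<sigma> * integral {x / \<sigma>..y / \<sigma>} f) {x..y}"
    using has_integral_stretch_real[OF integrable_integral[OF assms(2)], of "1 / \<sigma>"] assms(1) by simp
  from has_integral_mult_right[OF this, of "1 / \<sigma>"] have
    "((\<lambda>s. f (s / \<sigma>) / \<sigma>) has_integral integral {x / \<sigma>..y / \<sigma>} f) {x..y}"
    using assms(1) by simp
  then show ?thesis by (rule integral_unique[symmetric])
qed

text \<open>
  For each fixed \<open>\<omega>\<close> the increment of \<open>z \<mapsto> tail M Z (z / S \<omega>)\<close> is an integral over \<open>[x, y]\<close>: the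
  measure \<open>ds / s\<close> is invariant under scaling.  Fubini's theorem then exchanges this integral
  with the expectation.
\<close>

lemma product_tail_increments:
  assumes M: "prob_space M" and indep: "prob_space.indep_var M borel S borel Z"
    and S0: "\<And>\<omega>. S \<omega> \<ge> 0"
    and k[measurable]: "k \<in> borel_measurable borel" and k_bdd: "\<And>s. 0 < s \<Longrightarrow> \<bar>k s\<bar> \<le> B"
    and incr: "\<And>x y. 0 < x \<Longrightarrow> x \<le> y \<Longrightarrow>
      tail M Z y - tail M Z x = integral {x..y} (\<lambda>s. tail M Z s * (k s / s))"
    and xy: "0 < x" "x \<le> y"
  shows "tail M (\<lambda>\<omega>. S \<omega> * Z \<omega>) y - tail M (\<lambda>\<omega>. S \<omega> * Z \<omega>) x =
    integral {x..y} (\<lambda>s. (\<integral>\<omega>. (if S \<omega> = 0 then 0 else tail M Z (s / S \<omega>) * k (s / S \<omega>)) \<partial>M) / s)"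
proof -
  interpret prob_space M by fact
  define H where "H = tail M Z"
  define F where "F = tail M (\<lambda>\<omega>. S \<omega> * Z \<omega>)"
  have [measurable]: "S \<in> borel_measurable M" "Z \<in> borel_measurable M"
    using indep unfolding indep_var_distribution_eq by auto
  have [measurable]: "H \<in> borel_measurable borel"
    unfolding H_def by (intro borel_measurable_tail M) simp
  have H1: "0 \<le> H z" "H z \<le> 1" for z unfolding H_def using tail_bounds[OF M] by auto
  have B0: "B \<ge> 0" using k_bdd[of 1] by force
  define g where "g = (\<lambda>z \<omega>. if S \<omega> = 0 then 0 else H (z / S \<omega>))"
  have [measurable]: "g z \<in> borel_measurable M" for z unfolding g_def by measurable
  have F_eq: "F z = (\<integral>\<omega>. g z \<omega> \<partial>M)" if "z > 0" for z
    unfolding F_def tail_product_indep[OF M indep]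
    using that S0 by (intro Bochner_Integration.integral_cong) (auto simp: tail_scaled g_def H_def)
  have g_int: "integrable M (g z)" for z
    by (rule integrable_const_bound[where B=1]) (auto simp: g_def H1)
  define q where "q = (\<lambda>\<omega> s. if S \<omega> = 0 then 0 else H (s / S \<omega>) * k (s / S \<omega>))"
  define f where "f = (\<lambda>\<omega> s. indicator {x..y} s * (q \<omega> s / s))"
  have f_bdd: "\<bar>f \<omega> s\<bar> \<le> B / x" for \<omega> s
  proof (cases "S \<omega> = 0 \<or> s \<notin> {x..y}")
    case True
    then show ?thesis using B0 xy by (auto simp: f_def q_def)
  next
    case False
    then have s: "0 < s / S \<omega>" "x \<le> s" "s > 0" using S0[of \<omega>] xy by (auto simp: less_le)
    have "\<bar>H (s / S \<omega>)\<bar> * \<bar>k (s / S \<omega>)\<bar> \<le> 1 * B"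
      using H1[of "s / S \<omega>"] k_bdd[OF s(1)] by (intro mult_mono) auto
    then have "\<bar>q \<omega> s\<bar> \<le> B" using False by (simp add: q_def abs_mult)
    then have "\<bar>q \<omega> s\<bar> / s \<le> B / x" using s xy B0 by (intro frac_le) auto
    then show ?thesis using False s by (simp add: f_def)
  qed
  have f_meas[measurable]: "case_prod f \<in> borel_measurable (M \<Otimes>\<^sub>M lborel)"
    unfolding f_def q_def by measurable
  interpret P: pair_sigma_finite M lborel ..
  have f_int: "integrable (M \<Otimes>\<^sub>M lborel) (case_prod f)"
  proof (rule integrableI_bounded_set[where A="space M \<times> {x..y}" and B="B / x"])
    show "emeasure (M \<Otimes>\<^sub>M lborel) (space M \<times> {x..y}) < \<infinity>"
      using xy by (subst lborel.emeasure_pair_measure_Times) (auto simp: emeasure_space_1)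
    show "AE p in M \<Otimes>\<^sub>M lborel. p \<notin> space M \<times> {x..y} \<longrightarrow> case_prod f p = 0"
      by (intro AE_I2) (auto simp: f_def space_pair_measure indicator_def split: if_splits)
  qed (use f_bdd in auto)
  have f_line: "(\<integral>s. f \<omega> s \<partial>lborel) = g y \<omega> - g x \<omega>" if "\<omega> \<in> space M" for \<omega>
  proof (cases "S \<omega> = 0")
    case True
    then show ?thesis by (simp add: f_def q_def g_def)
  next
    case False
    then have S: "S \<omega> > 0" using S0[of \<omega>] by simp
    have q_meas: "(\<lambda>s. q \<omega> s / s) \<in> borel_measurable borel"
      unfolding q_def by measurable
    have "set_integrable lborel {x..y} (\<lambda>s. q \<omega> s / s)"
    proof (rule bounded_borel_integrable_on_interval(1)[OF q_meas])
      fix s assume "s \<in> {x..y}"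
      then show "\<bar>q \<omega> s / s\<bar> \<le> B / x" using f_bdd[of \<omega> s] by (simp add: f_def)
    qed
    from set_borel_integral_eq_integral(2)[OF this]
    have "(\<integral>s. f \<omega> s \<partial>lborel) = integral {x..y} (\<lambda>s. q \<omega> s / s)"
      by (simp add: set_lebesgue_integral_def f_def)
    also have "\<dots> = integral {x..y} (\<lambda>s. H (s / S \<omega>) * (k (s / S \<omega>) / (s / S \<omega>)) / S \<omega>)"
      using S by (simp add: q_def)
    also have "\<dots> = integral {x / S \<omega>..y / S \<omega>} (\<lambda>s. H s * (k s / s))"
    proof (rule integral_scaled_interval[OF S, symmetric])
      show "(\<lambda>s. H s * (k s / s)) integrable_on {x / S \<omega>..y / S \<omega>}"
      proof (rule bounded_borel_integrable_on_interval(2)[where K="1 * (B / (x / S \<omega>))"])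
        fix s assume s: "s \<in> {x / S \<omega>..y / S \<omega>}"
        have x': "x / S \<omega> > 0" using xy S by simp
        have "\<bar>k s\<bar> / s \<le> B / (x / S \<omega>)" using k_bdd[of s] s x' B0 by (intro frac_le) auto
        then show "\<bar>H s * (k s / s)\<bar> \<le> 1 * (B / (x / S \<omega>))"
          unfolding abs_mult using H1[of s] s x' by (intro mult_mono) auto
      qed measurable
    qed
    also have "\<dots> = H (y / S \<omega>) - H (x / S \<omega>)"
      unfolding H_def using incr[of "x / S \<omega>" "y / S \<omega>"] xy S by (simp add: divide_right_mono)
    finally show ?thesis using False by (simp add: g_def)
  qed
  have "F y - F x = (\<integral>\<omega>. g y \<omega> - g x \<omega> \<partial>M)"
    using xy g_int by (simp add: F_eq)
  also have "\<dots> = (\<integral>\<omega>. (\<integral>s. f \<omega> s \<partial>lborel) \<partial>M)"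
    by (intro Bochner_Integration.integral_cong refl) (simp add: f_line)
  also have "\<dots> = (\<integral>s. (\<integral>\<omega>. f \<omega> s \<partial>M) \<partial>lborel)"
    using P.Fubini_integral[OF f_int] by simp
  also have "\<dots> = (LINT s : {x..y} | lborel. (\<integral>\<omega>. q \<omega> s \<partial>M) / s)"
    by (simp add: set_lebesgue_integral_def f_def)
  also have "\<dots> = integral {x..y} (\<lambda>s. (\<integral>\<omega>. q \<omega> s \<partial>M) / s)"
  proof (rule set_borel_integral_eq_integral(2))
    show "set_integrable lborel {x..y} (\<lambda>s. (\<integral>\<omega>. q \<omega> s \<partial>M) / s)"
      using P.integrable_snd[OF f_int] by (simp add: set_integrable_def f_def)
  qed
  finally show ?thesis unfolding F_def q_def H_def .
qed

text \<open>
  The auxiliary function of the product is \<open>\<eta>F = N / F\<close> with \<open>N s = E[H (s / S) * \<eta> (s / S); S > 0]\<close>.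
  To bound it by a multiple of \<open>\<eta>s\<close>, large and small arguments are treated separately.  For large \<open>s\<close>,
  the Potter bound for \<open>H * \<eta>s\<close> and the \<open>r\<close>-th moment of \<open>S\<close> bound \<open>N s\<close> by a multiple of \<open>H s * \<eta>s s\<close>, and
  \<open>F s\<close> is at least a multiple of \<open>H s\<close> by Breiman's lemma.  For small \<open>s\<close> the function \<open>\<eta>F\<close> is bounded
  and \<open>\<eta>s\<close> is bounded below.
\<close>

lemma second_order_rv_product:
  assumes M: "prob_space M" and indep: "prob_space.indep_var M borel S borel Z"
    and S0: "\<And>\<omega>. S \<omega> \<ge> 0" and S_pos: "measure M {\<omega> \<in> space M. S \<omega> > 0} > 0"
    and rv: "second_order_rv (tail M Z) \<alpha> \<eta>s" and reg: "regularly_varying \<eta>s (- (\<alpha> * \<beta>))"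
    and \<alpha>: "\<alpha> > 0" and \<beta>: "\<beta> \<ge> 0" and r: "r > \<alpha> * (\<beta> + 1)"
    and S_int: "integrable M (\<lambda>\<omega>. S \<omega> powr r)"
  shows "second_order_rv (tail M (\<lambda>\<omega>. S \<omega> * Z \<omega>)) \<alpha> \<eta>s"
proof -
  interpret prob_space M by fact
  have S_meas[measurable]: "S \<in> borel_measurable M" and Z_meas[measurable]: "Z \<in> borel_measurable M"
    using indep unfolding indep_var_distribution_eq by auto
  define H where "H = tail M Z"
  define F where "F = tail M (\<lambda>\<omega>. S \<omega> * Z \<omega>)"
  have [measurable]: "H \<in> borel_measurable borel" "F \<in> borel_measurable borel"
    unfolding H_def F_def by (intro borel_measurable_tail M; simp)+
  have H1: "0 \<le> H z" "H z \<le> 1" for z unfolding H_def using tail_bounds[OF M] by auto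
  have H_pos: "H z > 0" if "0 < z" for z
    using second_order_rv_pos[OF rv that] by (simp add: H_def)
  have anti: "H y \<le> H x" "F y \<le> F x" if "x \<le> y" for x y
    using that unfolding H_def F_def by (auto intro!: tail_antimono M)
  have \<eta>_pos: "\<eta>s x > 0" if "x \<ge> 0" for x using second_order_rv_etas_pos[OF rv that] .
  have \<eta>_anti: "\<eta>s y \<le> \<eta>s x" if "0 \<le> x" "x \<le> y" for x y
    using second_order_rv_etas_antimono[OF rv that] .
  have r_gt: "r > \<alpha>"
  proof -
    have "\<alpha> * \<beta> \<ge> 0" "\<alpha> * (\<beta> + 1) = \<alpha> * \<beta> + \<alpha>" using \<alpha> \<beta> by (auto simp: algebra_simps)
    then show ?thesis using r by linarith
  qed
  obtain \<eta> C where \<eta>[measurable]: "\<eta> \<in> borel_measurable borel" and C: "C > 0"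
    and \<eta>C: "\<And>s. s \<ge> 0 \<Longrightarrow> \<bar>\<eta> s\<bar> \<le> C * \<eta>s s"
    and log_incr: "\<And>x y. 0 < x \<Longrightarrow> x \<le> y \<Longrightarrow>
      ln (tail M Z y) - ln (tail M Z x) = integral {x..y} (\<lambda>s. (\<eta> s - \<alpha>) / s)"
    by (rule second_order_rv_log_increments[OF rv]) (rule that)
  define B where "B = C * \<eta>s 0"
  have \<eta>B: "\<bar>\<eta> s\<bar> \<le> B" if "s > 0" for s
  proof -
    have "C * \<eta>s s \<le> C * \<eta>s 0" using \<eta>_anti[of 0 s] C that by (intro mult_left_mono) auto
    then show ?thesis using \<eta>C[of s] that by (simp add: B_def)
  qed
  have frac_bdd: "\<bar>(e - \<alpha>) / s\<bar> \<le> (b + \<alpha>) / x" if "0 < x" "x \<le> s" "\<bar>e\<bar> \<le> b" for e b x s :: real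
  proof -
    have "\<bar>e - \<alpha>\<bar> / s \<le> (b + \<alpha>) / x" using that \<alpha> by (intro frac_le) auto
    then show ?thesis using that by simp
  qed

  have H_incr: "H y - H x = integral {x..y} (\<lambda>s. H s * ((\<eta> s - \<alpha>) / s))" if "0 < x" "x \<le> y" for x y
  proof -
    have "\<forall>x y. 0 < x \<longrightarrow> x \<le> y \<longrightarrow> H y - H x = integral {x..y} (\<lambda>s. H s * ((\<eta> s - \<alpha>) / s))"
    proof (rule log_increments_iff_increments[where F=H and K="B + \<alpha>", THEN iffD1])
      show "\<forall>x y. 0 < x \<longrightarrow> x \<le> y \<longrightarrow> ln (H y) - ln (H x) = integral {x..y} (\<lambda>s. (\<eta> s - \<alpha>) / s)"
        unfolding H_def by (intro allI impI log_incr)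
      show "\<bar>(\<eta> s - \<alpha>) / s\<bar> \<le> (B + \<alpha>) / x" if "0 < x" "x \<le> s" for x s
        using frac_bdd[OF that] \<eta>B[of s] that by simp
    qed (auto intro: anti H_pos)
    from this[rule_format, OF that] show ?thesis .
  qed

  obtain K w0 where K: "K > 0" "w0 > 0" "\<And>v \<sigma> t. v \<ge> w0 \<Longrightarrow> \<sigma> \<ge> 0 \<Longrightarrow> t \<ge> 1 \<Longrightarrow>
      \<bar>tail M (\<lambda>\<omega>. \<sigma> * Z \<omega>) (t * v) / tail M Z v - \<sigma> powr \<alpha> * t powr (- \<alpha>)\<bar>
      \<le> K * \<eta>s v * (1 + \<sigma> powr r)"
    using scaled_tail_ratio_bound[OF M Z_meas rv reg \<alpha> \<beta> r] by metis
  define g where "g = (\<lambda>z \<omega>. tail M (\<lambda>\<omega>'. S \<omega> * Z \<omega>') z)"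
  have g_eq: "g z \<omega> = (if S \<omega> = 0 then 0 else H (z / S \<omega>))" if "z > 0" for z \<omega>
    unfolding g_def H_def by (rule tail_scaled[OF S0 that])
  have g_meas: "g z \<in> borel_measurable M" if "z > 0" for z
  proof -
    have "g z = (\<lambda>\<omega>. if S \<omega> = 0 then 0 else H (z / S \<omega>))" by (rule ext) (rule g_eq[OF that])
    moreover have "(\<lambda>\<omega>. if S \<omega> = 0 then 0 else H (z / S \<omega>)) \<in> borel_measurable M" by measurable
    ultimately show ?thesis by (simp only:)
  qed
  have g_int: "integrable M (g z)" if "z > 0" for z
    using g_meas[OF that] by (intro integrable_const_bound[where B=1])
      (auto simp: g_def tail_bounds[OF M])
  have F_eq: "F z = expectation (g z)" for z
    unfolding F_def g_def by (rule tail_product_indep[OF M indep])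

  have S\<alpha>_int: "integrable M (\<lambda>\<omega>. S \<omega> powr \<alpha>)"
  proof (rule Bochner_Integration.integrable_bound)
    show "integrable M (\<lambda>\<omega>. 1 + S \<omega> powr r)" using S_int by simp
    show "AE \<omega> in M. norm (S \<omega> powr \<alpha>) \<le> norm (1 + S \<omega> powr r)"
    proof (rule AE_I2)
      fix \<omega>
      have "S \<omega> powr \<alpha> \<le> 1 + S \<omega> powr r"
        using \<alpha> r_gt S0 by (intro powr_le_one_plus_powr) auto
      then show "norm (S \<omega> powr \<alpha>) \<le> norm (1 + S \<omega> powr r)" by simp
    qed
  qed simp
  \<comment> \<open>The limit in Breiman's lemma.\<close>
  define m where "m = expectation (\<lambda>\<omega>. S \<omega> powr \<alpha>)"
  have m: "m > 0"
  proof -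
    have "m \<ge> 0" unfolding m_def by simp
    moreover have "m \<noteq> 0"
    proof
      assume "m = 0"
      then have "AE \<omega> in M. S \<omega> powr \<alpha> = 0"
        using integral_nonneg_eq_0_iff_AE[OF S\<alpha>_int] by (simp add: m_def)
      then have "AE \<omega> in M. \<not> S \<omega> > 0" by eventually_elim auto
      then have "prob {\<omega> \<in> space M. S \<omega> > 0} = 0"
        by (subst prob_eq_0) auto
      then show False using S_pos by simp
    qed
    ultimately show ?thesis by simp
  qed
  define R where "R = expectation (\<lambda>\<omega>. 1 + S \<omega> powr r)"
  have breiman: "\<bar>F v / H v - m\<bar> \<le> K * \<eta>s v * R" if v: "v \<ge> w0" for v
  proof -
    have v0: "v > 0" using v K by simp
    have "F v / H v - m = expectation (\<lambda>\<omega>. g v \<omega> / H v - S \<omega> powr \<alpha>)"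
      using g_int[OF v0] S\<alpha>_int by (simp add: F_eq m_def)
    also have "\<bar>\<dots>\<bar> \<le> expectation (\<lambda>\<omega>. K * \<eta>s v * (1 + S \<omega> powr r))"
    proof (rule integral_abs_bound[THEN order_trans], rule integral_mono)
      show "\<bar>g v \<omega> / H v - S \<omega> powr \<alpha>\<bar> \<le> K * \<eta>s v * (1 + S \<omega> powr r)" for \<omega>
        using K(3)[OF v S0[of \<omega>], of 1] by (simp add: g_def H_def)
    qed (use g_int[OF v0] S\<alpha>_int S_int in auto)
    finally show ?thesis by (simp add: R_def)
  qed
  have "((\<lambda>v. K * \<eta>s v * R) \<longlongrightarrow> 0) at_top"
    using second_order_rv_etas_tendsto_0[OF rv] by (intro tendsto_mult_left_zero tendsto_mult_right_zero)
  then have "\<forall>\<^sub>F v in at_top. K * \<eta>s v * R < m / 2"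
    using m by (intro order_tendstoD) auto
  then obtain w1 where w1: "\<And>v. v \<ge> w1 \<Longrightarrow> K * \<eta>s v * R < m / 2"
    unfolding eventually_at_top_linorder by blast
  obtain A w2 where A: "A > 0" "\<And>v y. v \<ge> w2 \<Longrightarrow> y \<ge> 1 \<Longrightarrow> H (v / y) * \<eta>s (v / y) \<le> A * y powr r * (H v * \<eta>s v)"
  proof -
    have "tail M Z y \<le> tail M Z x" if "0 < x" "x \<le> y" for x y
      using that by (intro tail_antimono M) auto
    then obtain K' A w where "A > 0" "\<forall>v\<ge>w.
        (\<forall>t>0. \<bar>tail M Z (t * v) / tail M Z v - t powr (- \<alpha>)\<bar> \<le> K' * \<eta>s v * (1 + t powr (- r))) \<and>
        (\<forall>y\<ge>1. tail M Z (v / y) * \<eta>s (v / y) \<le> A * y powr r * (tail M Z v * \<eta>s v))"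
      using second_order_rv_ratio_bound[OF rv reg \<alpha> \<beta> _ tail_bounds(2)[OF M] r] by blast
    then show ?thesis using that[of A w] by (simp add: H_def)
  qed
  define w3 where "w3 = max w0 (max w1 w2)"
  have w3: "w3 > 0" "w3 \<ge> w0" "w3 \<ge> w1" "w3 \<ge> w2" using K by (auto simp: w3_def)
  have F_ge: "m / 2 * H v \<le> F v" if "v \<ge> w3" for v
  proof -
    have "m / 2 \<le> F v / H v" using breiman[of v] w1[of v] that w3 by linarith
    then show ?thesis using H_pos[of v] that w3 by (simp add: field_simps)
  qed
  have F_pos: "F z > 0" if "z > 0" for z
  proof -
    have "0 < m / 2 * H (max z w3)" using m H_pos that by simp
    also have "\<dots> \<le> F (max z w3)" by (rule F_ge) simp
    also have "\<dots> \<le> F z" by (rule anti) simp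
    finally show ?thesis .
  qed

  define N where "N = (\<lambda>s. expectation (\<lambda>\<omega>. if S \<omega> = 0 then 0 else H (s / S \<omega>) * \<eta> (s / S \<omega>)))"
  define \<eta>F where "\<eta>F = (\<lambda>s. if s > 0 then N s / F s else 0)"
  have [measurable]: "N \<in> borel_measurable borel" unfolding N_def by measurable
  have \<eta>F_meas[measurable]: "\<eta>F \<in> borel_measurable borel" unfolding \<eta>F_def by measurable
  have N_integrand_bdd: "\<bar>if S \<omega> = 0 then 0 else H (s / S \<omega>) * \<eta> (s / S \<omega>)\<bar> \<le> B * g s \<omega>"
    if "s > 0" for s \<omega>
    using that \<eta>B[of "s / S \<omega>"] S0[of \<omega>] H1[of "s / S \<omega>"]
    by (auto simp: g_eq abs_mult mult.commute[of B] less_le intro!: mult_left_mono)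
  have N_int: "integrable M (\<lambda>\<omega>. if S \<omega> = 0 then 0 else H (s / S \<omega>) * \<eta> (s / S \<omega>))" if "s > 0" for s
  proof (rule Bochner_Integration.integrable_bound)
    show "integrable M (\<lambda>\<omega>. B * g s \<omega>)" using g_int[OF that] by simp
    show "AE \<omega> in M. norm (if S \<omega> = 0 then 0 else H (s / S \<omega>) * \<eta> (s / S \<omega>)) \<le> norm (B * g s \<omega>)"
    proof (rule AE_I2)
      fix \<omega>
      show "norm (if S \<omega> = 0 then 0 else H (s / S \<omega>) * \<eta> (s / S \<omega>)) \<le> norm (B * g s \<omega>)"
        using N_integrand_bdd[OF that, of \<omega>] unfolding real_norm_def by linarith
    qed
  qed measurable
  have N_le_F: "\<bar>N s\<bar> \<le> B * F s" if "s > 0" for s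
  proof -
    have "\<bar>N s\<bar> \<le> expectation (\<lambda>\<omega>. B * g s \<omega>)"
      unfolding N_def using N_integrand_bdd[OF that] N_int[OF that] g_int[OF that]
      by (intro integral_abs_bound[THEN order_trans] integral_mono) auto
    then show ?thesis by (simp add: F_eq)
  qed
  have N_le_large: "\<bar>N s\<bar> \<le> C * (1 + A) * R * (H s * \<eta>s s)" if s: "s \<ge> w3" for s
  proof -
    have s0: "s > 0" using s w3 by simp
    have h0: "H s * \<eta>s s \<ge> 0" using H1[of s] \<eta>_pos[of s] s0 by simp
    have "\<bar>N s\<bar> \<le> expectation (\<lambda>\<omega>. C * (1 + A) * (H s * \<eta>s s) * (1 + S \<omega> powr r))"
      unfolding N_def
    proof (rule integral_abs_bound[THEN order_trans], rule integral_mono)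
      fix \<omega>
      show "\<bar>if S \<omega> = 0 then 0 else H (s / S \<omega>) * \<eta> (s / S \<omega>)\<bar>
          \<le> C * (1 + A) * (H s * \<eta>s s) * (1 + S \<omega> powr r)"
      proof (cases "S \<omega> = 0")
        case True
        then show ?thesis using C A h0 by simp
      next
        case False
        then have S: "S \<omega> > 0" using S0[of \<omega>] by simp
        have "\<bar>H (s / S \<omega>) * \<eta> (s / S \<omega>)\<bar> \<le> H (s / S \<omega>) * (C * \<eta>s (s / S \<omega>))"
          unfolding abs_mult using H1 \<eta>C[of "s / S \<omega>"] S s0 by (intro mult_mono) auto
        also have "\<dots> = C * (H (s / S \<omega>) * \<eta>s (s / S \<omega>))" by simp
        also have "\<dots> \<le> C * ((1 + A) * (1 + S \<omega> powr r) * (H s * \<eta>s s))"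
        proof (intro mult_left_mono)
          show "H (s / S \<omega>) * \<eta>s (s / S \<omega>) \<le> (1 + A) * (1 + S \<omega> powr r) * (H s * \<eta>s s)"
          proof (cases "S \<omega> \<ge> 1")
            case True
            have "H (s / S \<omega>) * \<eta>s (s / S \<omega>) \<le> A * S \<omega> powr r * (H s * \<eta>s s)"
              using A(2)[of s "S \<omega>"] True s w3 by simp
            also have "\<dots> \<le> (1 + A) * (1 + S \<omega> powr r) * (H s * \<eta>s s)"
              using A h0 by (intro mult_right_mono mult_mono) auto
            finally show ?thesis .
          next
            case False
            then have le: "s \<le> s / S \<omega>" using S s0 by (simp add: field_simps)
            have "H (s / S \<omega>) * \<eta>s (s / S \<omega>) \<le> 1 * (H s * \<eta>s s)"
              using anti(1)[OF le] \<eta>_anti[OF _ le] \<eta>_pos[of "s / S \<omega>"] s0 S H1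
              by (auto intro!: mult_mono)
            also have "\<dots> \<le> (1 + A) * (1 + S \<omega> powr r) * (H s * \<eta>s s)"
            proof (intro mult_right_mono h0)
              have "1 * 1 \<le> (1 + A) * (1 + S \<omega> powr r)" using A by (intro mult_mono) auto
              then show "1 \<le> (1 + A) * (1 + S \<omega> powr r)" by simp
            qed
            finally show ?thesis .
          qed
        qed (use C in simp)
        finally show ?thesis using False by (simp add: mult_ac)
      qed
    qed (use N_int[OF s0] S_int in auto)
    then show ?thesis by (simp add: R_def mult_ac)
  qed
  \<comment> \<open>The first summand serves large arguments, the second small ones, and \<open>1\<close> ensures positivity.\<close>
  define CF where "CF = 2 * C * (1 + A) * R / m + B / \<eta>s w3 + 1"
  have R0: "R \<ge> 0" unfolding R_def by (intro integral_nonneg_AE) (auto intro: add_nonneg_nonneg)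
  have B0: "B > 0" using C \<eta>_pos[of 0] by (simp add: B_def)
  have CF_parts: "2 * C * (1 + A) * R / m \<ge> 0" "B / \<eta>s w3 > 0"
    using C A R0 m B0 \<eta>_pos[of w3] w3 by auto
  have \<eta>F_bdd: "\<bar>\<eta>F s\<bar> \<le> CF * \<eta>s s" if s: "s \<ge> 0" for s
  proof (cases "s = 0")
    case True
    then show ?thesis using CF_parts \<eta>_pos[of 0] by (simp add: \<eta>F_def CF_def)
  next
    case False
    then have s0: "s > 0" using s by simp
    have abs_eq: "\<bar>\<eta>F s\<bar> = \<bar>N s\<bar> / F s" using s0 F_pos[OF s0] by (simp add: \<eta>F_def)
    show ?thesis
    proof (cases "s \<ge> w3")
      case True
      have "\<bar>N s\<bar> \<le> C * (1 + A) * R * (H s * \<eta>s s)" by (rule N_le_large[OF True])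
      also have "\<dots> = 2 * C * (1 + A) * R / m * \<eta>s s * (m / 2 * H s)" using m by simp
      also have "\<dots> \<le> CF * \<eta>s s * F s"
        using CF_parts F_ge[OF True] \<eta>_pos[OF s] m H1 by (intro mult_mono) (auto simp: CF_def)
      finally show ?thesis unfolding abs_eq using F_pos[OF s0] by (simp add: field_simps)
    next
      case False
      have "\<bar>N s\<bar> / F s \<le> B" using N_le_F[OF s0] F_pos[OF s0] by (simp add: field_simps)
      also have "\<dots> = B / \<eta>s w3 * \<eta>s w3" using \<eta>_pos[of w3] w3 by simp
      also have "\<dots> \<le> CF * \<eta>s s"
        using CF_parts \<eta>_anti[of s w3] s False \<eta>_pos[of w3] w3 by (intro mult_mono) (auto simp: CF_def)
      finally show ?thesis unfolding abs_eq .
    qed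
  qed
  have CF0: "CF > 0" using CF_parts by (simp add: CF_def)
  have \<eta>F_glob: "\<bar>\<eta>F s\<bar> \<le> B" if "s > 0" for s
    using N_le_F[OF that] F_pos[OF that] that by (simp add: \<eta>F_def field_simps)

  have F_incr: "F y - F x = integral {x..y} (\<lambda>s. F s * ((\<eta>F s - \<alpha>) / s))" if xy: "0 < x" "x \<le> y" for x y
  proof -
    have "F y - F x = integral {x..y}
        (\<lambda>s. expectation (\<lambda>\<omega>. if S \<omega> = 0 then 0 else H (s / S \<omega>) * (\<eta> (s / S \<omega>) - \<alpha>)) / s)"
      unfolding F_def H_def
    proof (rule product_tail_increments[OF M indep S0, where B="B + \<alpha>"])
      show "\<bar>\<eta> s - \<alpha>\<bar> \<le> B + \<alpha>" if "0 < s" for s using \<eta>B[OF that] \<alpha> by simp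
      show "tail M Z y - tail M Z x = integral {x..y} (\<lambda>s. tail M Z s * ((\<eta> s - \<alpha>) / s))"
        if "0 < x" "x \<le> y" for x y using H_incr[OF that] unfolding H_def .
    qed (use xy in auto)
    also have "\<dots> = integral {x..y} (\<lambda>s. F s * ((\<eta>F s - \<alpha>) / s))"
    proof (rule Henstock_Kurzweil_Integration.integral_cong)
      fix s assume "s \<in> {x..y}"
      then have s0: "s > 0" using xy by simp
      have "expectation (\<lambda>\<omega>. if S \<omega> = 0 then 0 else H (s / S \<omega>) * (\<eta> (s / S \<omega>) - \<alpha>))
          = expectation (\<lambda>\<omega>. (if S \<omega> = 0 then 0 else H (s / S \<omega>) * \<eta> (s / S \<omega>)) - \<alpha> * g s \<omega>)"
        by (intro Bochner_Integration.integral_cong) (auto simp: g_eq[OF s0] algebra_simps)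
      also have "\<dots> = N s - \<alpha> * F s"
        using N_int[OF s0] g_int[OF s0] by (simp add: N_def F_eq)
      also have "\<dots> = F s * (\<eta>F s - \<alpha>)"
        using s0 F_pos[OF s0] by (simp add: \<eta>F_def field_simps)
      finally show "expectation (\<lambda>\<omega>. if S \<omega> = 0 then 0 else H (s / S \<omega>) * (\<eta> (s / S \<omega>) - \<alpha>)) / s
          = F s * ((\<eta>F s - \<alpha>) / s)" by simp
    qed
    finally show ?thesis .
  qed
  have F_log_incr: "\<forall>x y. 0 < x \<longrightarrow> x \<le> y \<longrightarrow> ln (F y) - ln (F x) = integral {x..y} (\<lambda>s. (\<eta>F s - \<alpha>) / s)"
  proof (rule log_increments_iff_increments[where F=F and K="B + \<alpha>", THEN iffD2])
    show "\<bar>(\<eta>F s - \<alpha>) / s\<bar> \<le> (B + \<alpha>) / x" if "0 < x" "x \<le> s" for x s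
      using frac_bdd[OF that] \<eta>F_glob[of s] that by simp
    show "\<forall>x y. 0 < x \<longrightarrow> x \<le> y \<longrightarrow> F y - F x = integral {x..y} (\<lambda>s. F s * ((\<eta>F s - \<alpha>) / s))"
      by (intro allI impI F_incr)
  qed (auto intro: anti F_pos)
  have "\<exists>c>0. \<forall>z>0. F z = c * z powr (- \<alpha>) * exp (LBINT s=1..ereal z. \<eta>F s / s)"
  proof (rule karamata_representation_iff_log_increments[where B=B, THEN iffD2])
    show "(\<forall>z>0. F z > 0) \<and> (\<forall>x y. 0 < x \<longrightarrow> x \<le> y \<longrightarrow>
        ln (F y) - ln (F x) = integral {x..y} (\<lambda>s. (\<eta>F s - \<alpha>) / s))"
      using F_log_incr by (intro conjI) (simp add: F_pos)
  qed (use \<eta>F_glob in auto)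
  then obtain c where c: "c > 0" "\<forall>z>0. F z = c * z powr (- \<alpha>) * exp (LBINT s=1..ereal z. \<eta>F s / s)"
    by (elim exE conjE) (rule that)
  have bnd: "\<forall>s\<ge>0. \<bar>\<eta>F s\<bar> \<le> CF * \<eta>s s" using \<eta>F_bdd by simp
  have rep: "\<exists>\<eta> c C. \<eta> \<in> borel_measurable borel \<and> c > 0 \<and> C > 0 \<and>
      (\<forall>z>0. F z = c * z powr (- \<alpha>) * exp (LBINT s=1..ereal z. \<eta> s / s)) \<and>
      (\<forall>s\<ge>0. \<bar>\<eta> s\<bar> \<le> C * \<eta>s s)"
    by (rule exI[of _ \<eta>F], rule exI[of _ c], rule exI[of _ CF])
       (rule conjI[OF \<eta>F_meas conjI[OF c(1) conjI[OF CF0 conjI[OF c(2) bnd]]]])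
  show ?thesis
    using rv rep unfolding F_def[symmetric] second_order_rv_def by (elim conjE) (intro conjI)
qed

section \<open>Measurability of the suprema and the rates\<close>

text \<open>
  Reduces an uncountable supremum to a countable one, which is what makes it measurable.
\<close>

lemma SUP_right_continuous_eq_SUP_rationals:
  fixes f :: "real \<Rightarrow> real"
  assumes bdd: "bdd_above (f ` {0..})" and rc: "\<And>s. 0 \<le> s \<Longrightarrow> (f \<longlongrightarrow> f s) (at_right s)"
  shows "(SUP s\<in>{0..}. f s) = (SUP s\<in>\<rat> \<inter> {0..}. f s)"
proof (rule antisym)
  have bdd': "bdd_above (f ` (\<rat> \<inter> {0..}))" by (rule bdd_above_mono[OF bdd]) auto
  show "(SUP s\<in>\<rat> \<inter> {0..}. f s) \<le> (SUP s\<in>{0..}. f s)"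
    by (rule cSUP_subset_mono) (use bdd in \<open>auto intro: exI[of _ 0]\<close>)
  show "(SUP s\<in>{0..}. f s) \<le> (SUP s\<in>\<rat> \<inter> {0..}. f s)"
  proof (rule cSUP_least, simp, rule ccontr)
    fix s :: real assume s: "s \<in> {0..}" and "\<not> f s \<le> (SUP s\<in>\<rat> \<inter> {0..}. f s)"
    then have "\<forall>\<^sub>F t in at_right s. (SUP s\<in>\<rat> \<inter> {0..}. f s) < f t"
      using rc[of s] by (intro order_tendstoD(1)) auto
    then obtain b where b: "b > s" "\<And>t. s < t \<Longrightarrow> t < b \<Longrightarrow> (SUP s\<in>\<rat> \<inter> {0..}. f s) < f t"
      unfolding eventually_at_right_field by blast
    obtain q where q: "q \<in> \<rat>" "s < q" "q < b" using Rats_dense_in_real[OF b(1)] by blast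
    then have "f q \<le> (SUP s\<in>\<rat> \<inter> {0..}. f s)" using s by (intro cSUP_upper[OF _ bdd']) auto
    then show False using b(2)[of q] q by simp
  qed
qed

lemma G_level_distance_right_continuous:
  assumes M: "prob_space M" and [measurable]: "Z \<in> borel_measurable M"
    and u: "u > 0" and p: "p \<ge> 1" and s: "s \<ge> 0"
  shows "((\<lambda>s. \<bar>G_level M Z \<sigma> u x s - \<sigma> x powr \<alpha> * T_lim \<alpha> s\<bar> powr p) \<longlongrightarrow>
    \<bar>G_level M Z \<sigma> u x s - \<sigma> x powr \<alpha> * T_lim \<alpha> s\<bar> powr p) (at_right s)"
proof -
  have lim: "filterlim (\<lambda>t. (1 + t) * u) (at_right ((1 + s) * u)) (at_right s)"
    unfolding filterlim_at using u
    by (auto intro!: tendsto_intros simp: eventually_at_right_less eventually_mono[OF eventually_at_right_less[of s]])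
  have "((\<lambda>t. tail M (\<lambda>\<omega>. \<sigma> x * Z \<omega>) ((1 + t) * u)) \<longlongrightarrow> tail M (\<lambda>\<omega>. \<sigma> x * Z \<omega>) ((1 + s) * u)) (at_right s)"
    by (rule filterlim_compose[OF tail_right_continuous[OF M] lim]) simp
  then show ?thesis
    unfolding G_level_def T_lim_def divide_inverse using p s
    by (intro tendsto_powr2 tendsto_intros) auto
qed

lemma sup_G_level_distance_measurable:
  assumes M: "prob_space M" and Z[measurable]: "Z \<in> borel_measurable M"
    and [measurable]: "X \<in> borel_measurable M" "\<sigma> \<in> borel_measurable borel"
    and \<sigma>0: "\<And>x. \<sigma> x \<ge> 0" and u: "u > 0" and p: "p \<ge> 1" and \<alpha>: "\<alpha> > 0"
  shows "(\<lambda>\<omega>. SUP s\<in>{0..}. \<bar>G_level M Z \<sigma> u (X \<omega>) s - \<sigma> (X \<omega>) powr \<alpha> * T_lim \<alpha> s\<bar> powr p)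
    \<in> borel_measurable M"
proof -
  define f where "f = (\<lambda>s \<omega>. \<bar>G_level M Z \<sigma> u (X \<omega>) s - \<sigma> (X \<omega>) powr \<alpha> * T_lim \<alpha> s\<bar> powr p)"
  have [measurable]: "tail M Z \<in> borel_measurable borel" by (rule borel_measurable_tail[OF M Z])
  have f_meas: "f s \<in> borel_measurable M" if "s \<ge> 0" for s
  proof -
    have "G_level M Z \<sigma> u (X \<omega>) s
        = (if \<sigma> (X \<omega>) = 0 then 0 else tail M Z ((1 + s) * u / \<sigma> (X \<omega>))) / tail M Z u" for \<omega>
      unfolding G_level_def using that u by (subst tail_scaled[OF \<sigma>0]) auto
    then show ?thesis unfolding f_def by simp
  qed
  have bdd: "bdd_above ((\<lambda>s. f s \<omega>) ` {0..})" for \<omega>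
    unfolding f_def by (rule bdd_above_G_level[OF M \<alpha> p])
  have "(\<lambda>\<omega>. SUP s\<in>\<rat> \<inter> {0..}. f s \<omega>) \<in> borel_measurable M"
  proof (rule borel_measurable_cSUP)
    show "bdd_above ((\<lambda>s. f s \<omega>) ` (\<rat> \<inter> {0..}))" for \<omega>
      by (rule bdd_above_mono[OF bdd[of \<omega>]]) auto
  qed (auto intro: f_meas countable_rat countable_subset)
  also have "(\<lambda>\<omega>. SUP s\<in>\<rat> \<inter> {0..}. f s \<omega>) = (\<lambda>\<omega>. SUP s\<in>{0..}. f s \<omega>)"
    using G_level_distance_right_continuous[OF M Z u p]
    by (intro ext SUP_right_continuous_eq_SUP_rationals[symmetric] bdd) (simp add: f_def)
  finally show ?thesis by (simp add: f_def)
qed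

theorem proposition2p8:
  fixes M :: "'a measure" and X Z :: "'a \<Rightarrow> real" and \<sigma> :: "real \<Rightarrow> real"
    and \<eta>s :: "real \<Rightarrow> real" and u :: "nat \<Rightarrow> real" and \<alpha> \<beta> \<epsilon> :: real
    and F :: "real \<Rightarrow> real"
  assumes "prob_space M"
    and "\<alpha> > 0" and "\<beta> \<ge> 0"
    and "Z \<in> borel_measurable M"
    and "second_order_rv (tail M Z) \<alpha> \<eta>s"
    and "regularly_varying \<eta>s (- (\<alpha> * \<beta>))"
    and "distributed M lborel X std_normal_density"
    and "prob_space.indep_var M borel X borel Z"
    and "\<sigma> \<in> borel_measurable borel" and "\<And>x. \<sigma> x \<ge> 0"
    and "measure M {\<omega> \<in> space M. \<sigma> (X \<omega>) > 0} > 0"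
    and "\<epsilon> > 0"
    and "integrable M (\<lambda>\<omega>. \<sigma> (X \<omega>) powr (\<alpha> * (\<beta> + 1) + \<epsilon>))"
    and "F = tail M (\<lambda>\<omega>. \<sigma> (X \<omega>) * Z \<omega>)"
    and "filterlim u at_top sequentially"
  shows "second_order_rv F \<alpha> \<eta>s \<and>
    (\<lambda>n. SUP s\<in>{0..}. \<bar>T_level F (u n) s - T_lim \<alpha> s\<bar>) \<in> O(\<lambda>n. \<eta>s (u n)) \<and>
    (\<forall>p\<ge>1. p * \<alpha> * (\<beta> + 1) < \<alpha> * (\<beta> + 1) + \<epsilon> \<longrightarrow>
      (\<forall>\<^sub>F n in sequentially. integrable M (\<lambda>\<omega>. SUP s\<in>{0..}.
         \<bar>G_level M Z \<sigma> (u n) (X \<omega>) s - \<sigma> (X \<omega>) powr \<alpha> * T_lim \<alpha> s\<bar> powr p)) \<and>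
      (\<lambda>n. integral\<^sup>L M (\<lambda>\<omega>. SUP s\<in>{0..}.
         \<bar>G_level M Z \<sigma> (u n) (X \<omega>) s - \<sigma> (X \<omega>) powr \<alpha> * T_lim \<alpha> s\<bar> powr p))
        \<in> O(\<lambda>n. \<eta>s (u n) powr p))"
proof -
  note M = assms(1) and \<alpha> = assms(2) and \<beta> = assms(3) and Z[measurable] = assms(4)
    and rv = assms(5) and reg = assms(6) and indep = assms(8) and \<sigma>[measurable] = assms(9)
    and \<sigma>0 = assms(10) and \<epsilon> = assms(12) and F = assms(14) and u = assms(15)
  interpret prob_space M by fact
  have X[measurable]: "X \<in> borel_measurable M"
    using indep unfolding indep_var_distribution_eq by auto
  define \<kappa> where "\<kappa> = \<alpha> * (\<beta> + 1) + \<epsilon>"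
  have \<kappa>: "\<kappa> > \<alpha> * (\<beta> + 1)" "\<kappa> > 0"
  proof -
    have "\<alpha> * (\<beta> + 1) \<ge> 0" using \<alpha> \<beta> by simp
    then show "\<kappa> > \<alpha> * (\<beta> + 1)" "\<kappa> > 0" using \<epsilon> unfolding \<kappa>_def by linarith+
  qed
  have S_int: "integrable M (\<lambda>\<omega>. \<sigma> (X \<omega>) powr \<kappa>)" using assms(13) unfolding \<kappa>_def .
  have indep': "indep_var borel (\<lambda>\<omega>. \<sigma> (X \<omega>)) borel Z"
    using indep_var_compose[OF indep, of \<sigma> borel "\<lambda>z. z" borel, OF \<sigma> measurable_ident_sets[OF refl]]
    unfolding comp_def .
  have u_large: "\<forall>\<^sub>F n in sequentially. u n \<ge> w" for w
    using u by (simp add: filterlim_at_top)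
  have \<eta>_pos: "\<eta>s x > 0" if "x \<ge> 0" for x using second_order_rv_etas_pos[OF rv that] .

  have F_rv: "second_order_rv F \<alpha> \<eta>s"
    unfolding F
    by (rule second_order_rv_product[OF M indep' \<sigma>0 assms(11) rv reg \<alpha> \<beta> \<kappa>(1) S_int])

  have T: "(\<lambda>n. SUP s\<in>{0..}. \<bar>T_level F (u n) s - T_lim \<alpha> s\<bar>) \<in> O(\<lambda>n. \<eta>s (u n))"
  proof -
    obtain K w0 where K: "K > 0" "w0 > 0"
      "\<And>v t. v \<ge> w0 \<Longrightarrow> t \<ge> 1 \<Longrightarrow> \<bar>F (t * v) / F v - t powr (- \<alpha>)\<bar> \<le> K * \<eta>s v"
      using second_order_rv_ratio_bound_right[OF F_rv \<alpha>] by metis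
    have "norm (SUP s\<in>{0..}. \<bar>T_level F (u n) s - T_lim \<alpha> s\<bar>) \<le> K * norm (\<eta>s (u n))"
      if n: "u n \<ge> w0" for n
    proof -
      have "(SUP s\<in>{0..}. \<bar>T_level F (u n) s - T_lim \<alpha> s\<bar>) \<le> K * \<eta>s (u n)"
      proof (rule cSUP_least)
        fix s :: real assume "s \<in> {0..}"
        then show "\<bar>T_level F (u n) s - T_lim \<alpha> s\<bar> \<le> K * \<eta>s (u n)"
          using K(3)[OF n, of "1 + s"] by (simp add: T_level_def T_lim_def mult.commute)
      qed simp
      moreover have "\<bar>T_level F (u n) 0 - T_lim \<alpha> 0\<bar> \<le> (SUP s\<in>{0..}. \<bar>T_level F (u n) s - T_lim \<alpha> s\<bar>)"
        unfolding F by (rule cSUP_upper[OF _ bdd_above_T_level[OF M \<alpha>]]) simp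
      ultimately show ?thesis using K \<eta>_pos[of "u n"] n by simp
    qed
    then show ?thesis using u_large[of w0] by (intro bigoI[where c=K]) (auto elim: eventually_mono)
  qed

  have G: "(\<forall>\<^sub>F n in sequentially. integrable M (\<lambda>\<omega>. SUP s\<in>{0..}.
         \<bar>G_level M Z \<sigma> (u n) (X \<omega>) s - \<sigma> (X \<omega>) powr \<alpha> * T_lim \<alpha> s\<bar> powr p)) \<and>
      (\<lambda>n. integral\<^sup>L M (\<lambda>\<omega>. SUP s\<in>{0..}.
         \<bar>G_level M Z \<sigma> (u n) (X \<omega>) s - \<sigma> (X \<omega>) powr \<alpha> * T_lim \<alpha> s\<bar> powr p))
        \<in> O(\<lambda>n. \<eta>s (u n) powr p)"
    if p: "p \<ge> 1" and p_small: "p * \<alpha> * (\<beta> + 1) < \<alpha> * (\<beta> + 1) + \<epsilon>" for p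
  proof -
    \<comment> \<open>With this exponent the \<open>p\<close>-th power of \<open>1 + \<sigma> powr r\<close> is of the integrable order \<open>1 + \<sigma> powr \<kappa>\<close>.\<close>
    define r where "r = \<kappa> / p"
    have r: "r > \<alpha> * (\<beta> + 1)" using p p_small by (simp add: r_def \<kappa>_def field_simps)
    obtain K w0 where K: "K > 0" "w0 > 0" "\<And>v y t. v \<ge> w0 \<Longrightarrow> y \<ge> 0 \<Longrightarrow> t \<ge> 1 \<Longrightarrow>
        \<bar>tail M (\<lambda>\<omega>. y * Z \<omega>) (t * v) / tail M Z v - y powr \<alpha> * t powr (- \<alpha>)\<bar>
        \<le> K * \<eta>s v * (1 + y powr r)"
      using scaled_tail_ratio_bound[OF M Z rv reg \<alpha> \<beta> r] by metis
    define D where "D = (\<lambda>n \<omega>. SUP s\<in>{0..}.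
         \<bar>G_level M Z \<sigma> (u n) (X \<omega>) s - \<sigma> (X \<omega>) powr \<alpha> * T_lim \<alpha> s\<bar> powr p)"
    have D_nonneg: "0 \<le> D n \<omega>" for n \<omega>
    proof -
      have "\<bar>G_level M Z \<sigma> (u n) (X \<omega>) 0 - \<sigma> (X \<omega>) powr \<alpha> * T_lim \<alpha> 0\<bar> powr p \<le> D n \<omega>"
        unfolding D_def by (rule cSUP_upper[OF _ bdd_above_G_level[OF M \<alpha> p]]) simp
      then show ?thesis by (rule order_trans[rotated]) simp
    qed
    have D_le: "D n \<omega> \<le> (2 * K * \<eta>s (u n)) powr p * (1 + \<sigma> (X \<omega>) powr \<kappa>)" if n: "u n \<ge> w0" for n \<omega>
    proof -
      define y where "y = \<sigma> (X \<omega>)"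
      have y: "y \<ge> 0" using \<sigma>0 by (simp add: y_def)
      have \<eta>n: "\<eta>s (u n) > 0" using \<eta>_pos[of "u n"] n K by simp
      have "D n \<omega> \<le> (K * \<eta>s (u n) * (1 + y powr r)) powr p"
        unfolding D_def
      proof (rule cSUP_least)
        fix s :: real assume "s \<in> {0..}"
        then have "\<bar>G_level M Z \<sigma> (u n) (X \<omega>) s - \<sigma> (X \<omega>) powr \<alpha> * T_lim \<alpha> s\<bar>
            \<le> K * \<eta>s (u n) * (1 + y powr r)"
          using K(3)[OF n y, of "1 + s"] by (simp add: G_level_def T_lim_def y_def)
        then show "\<bar>G_level M Z \<sigma> (u n) (X \<omega>) s - \<sigma> (X \<omega>) powr \<alpha> * T_lim \<alpha> s\<bar> powr p
            \<le> (K * \<eta>s (u n) * (1 + y powr r)) powr p"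
          using p by (intro powr_mono2) auto
      qed simp
      also have "\<dots> \<le> (K * \<eta>s (u n) * (2 * max 1 (y powr r))) powr p"
        using K \<eta>n p by (intro powr_mono2 mult_left_mono) auto
      also have "\<dots> = (2 * K * \<eta>s (u n)) powr p * max 1 (y powr r) powr p"
        using K \<eta>n by (simp add: powr_mult mult_ac)
      also have "max 1 (y powr r) powr p \<le> 1 + y powr \<kappa>"
        using p by (auto simp: max_def powr_powr r_def)
      finally show ?thesis by (simp add: y_def mult_left_mono)
    qed
    have D_int: "integrable M (D n)" if n: "u n \<ge> w0" for n
    proof (rule Bochner_Integration.integrable_bound)
      show "integrable M (\<lambda>\<omega>. (2 * K * \<eta>s (u n)) powr p * (1 + \<sigma> (X \<omega>) powr \<kappa>))"
        using S_int by simp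
      show "D n \<in> borel_measurable M"
        unfolding D_def using n K
        by (intro sup_G_level_distance_measurable M Z X \<sigma> \<sigma>0 p \<alpha>) auto
      show "AE \<omega> in M. norm (D n \<omega>) \<le> norm ((2 * K * \<eta>s (u n)) powr p * (1 + \<sigma> (X \<omega>) powr \<kappa>))"
      proof (rule AE_I2)
        fix \<omega>
        show "norm (D n \<omega>) \<le> norm ((2 * K * \<eta>s (u n)) powr p * (1 + \<sigma> (X \<omega>) powr \<kappa>))"
          using D_le[OF n, of \<omega>] D_nonneg[of n \<omega>] unfolding real_norm_def by linarith
      qed
    qed
    define R where "R = expectation (\<lambda>\<omega>. 1 + \<sigma> (X \<omega>) powr \<kappa>)"
    have "norm (expectation (D n)) \<le> (2 * K) powr p * R * norm (\<eta>s (u n) powr p)"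
      if n: "u n \<ge> w0" for n
    proof -
      have \<eta>n: "\<eta>s (u n) > 0" using \<eta>_pos[of "u n"] n K by simp
      have "expectation (D n) \<le> expectation (\<lambda>\<omega>. (2 * K * \<eta>s (u n)) powr p * (1 + \<sigma> (X \<omega>) powr \<kappa>))"
        using D_int[OF n] S_int D_le[OF n] by (intro integral_mono) auto
      also have "\<dots> = (2 * K * \<eta>s (u n)) powr p * R"
        unfolding R_def by (rule integral_mult_right_zero)
      also have "\<dots> = (2 * K) powr p * R * norm (\<eta>s (u n) powr p)"
        using K \<eta>n by (simp add: powr_mult)
      finally show ?thesis using D_nonneg by (simp add: integral_nonneg_AE)
    qed
    then have "(\<lambda>n. expectation (D n)) \<in> O(\<lambda>n. \<eta>s (u n) powr p)"
      using u_large[of w0] by (intro bigoI[where c="(2 * K) powr p * R"]) (auto elim: eventually_mono)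
    moreover have "\<forall>\<^sub>F n in sequentially. integrable M (D n)"
      using u_large[of w0] by eventually_elim (rule D_int)
    ultimately show ?thesis unfolding D_def by blast
  qed
  show ?thesis using F_rv T G by blast
qed

end
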